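(* Let $\beta\in(0,1)$ and an integer $m\ge 1$ be fixed. If $$\Sigma_n \in \{ F_n(f),\ F_n^{\beta}(f),\ F_n(f_1),\ F_n^{\beta}(f_m),\ I_n(f),\ I_n^{\beta}(f),\ I_n(f_1),\ I_n^{\beta}(f_m) \},$$ then $$\Sigma_n = \frac{|\Phi|}{\pi\sqrt{\det(S^TS)}}\, n^2\log n + \mathcal{O}(n^2)\qquad\text{as } n\to\infty,$$ where $S$ is the $|\Phi|\times 2$ matrix whose $\ell$-th row is $(s_{1,\ell},s_{2,\ell})$, $\ell=1,\dots,|\Phi|$.
   Context: Let $\Phi=\{\mathbf b_1,\dots,\mathbf b_{|\Phi|}\}$ be a finite collection of nonzero vectors in a two-dimensional real vector space generating a lattice $\Lambda=\mathbb Z\Phi$ of full rank, with $\{\mathbf b_1,\mathbf b_2\}$ a basis of $\Lambda$. Write $\mathbf b_\ell=s_{1,\ell}\mathbf b_1+s_{2,\ell}\mathbf b_2$ and $\mathbf s_\ell=(s_{1,\ell},s_{2,\ell})\in\mathbb Z^2\setminus\{\mathbf 0\}$, so $\mathbf s_1=(1,0)$, $\mathbf s_2=(0,1)$. $\Phi$ is fixed; implied constants may depend on it (and on $\beta,m$). Let $\overline s=\max_{\ell}\|\mathbf s_\ell\|$ (Euclidean norm). For $\mathbf x\in\mathbb R^2$ and integers $m\ge1$ put $$\psi(\mathbf x)=1-\frac1{|\Phi|}\sum_{\ell=1}^{|\Phi|}\cos(\mathbf s_\ell\cdot\mathbf x),\qquad p_m(\mathbf x)=\frac1{|\Phi|}\sum_{\ell=1}^{|\Phi|}\sum_{j=1}^m\frac{(-1)^{j+1}(\mathbf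 s_\ell\cdot\mathbf x)^{2j}}{(2j)!},\qquad f=\frac1\psi,\qquad f_m=\frac1{p_m}.$$ For a positive integer $n$ let $\Delta_n=2\pi/n$, $t_j=2\pi j/n$ and $x_j=t_j-\pi/n$ ($j\in\mathbb Z$), $\mathbf t_{j,k}=(t_j,t_k)$, $X_{j,k}=[x_j,x_{j+1}]\times[x_k,x_{k+1}]$, and $$D_n=\bigcup_{\mathbf t_{j,k}\in[-\pi,\pi)^2\setminus\{\mathbf 0\}}X_{j,k},\qquad D_n^\beta=\bigcup_{|t_j|,|t_k|\le \sqrt{5(1-\beta)}/\overline s,\ (t_j,t_k)\ne(0,0)}X_{j,k}.$$ For a function $g$ define $$F_n(g)=\sum_{\mathbf t_{j,k}\in D_n}g(\mathbf t_{j,k}),\quad I_n(g)=\frac1{\Delta_n^2}\iint_{D_n}g(\mathbf x)\,d\mathbf x,\quad F_n^\beta(g)=\sum_{\mathbf t_{j,k}\in D_n^\beta}g(\mathbf t_{j,k}),\quad I_n^\beta(g)=\frac1{\Delta_n^2}\iint_{D_n^\beta}g(\mathbf x)\,d\mathbf x .$$ *)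

theory Defs
  imports "HOL-Analysis.Analysis" "HOL-Library.Landau_Symbols"
begin

abbreviation int_scale :: "int \<Rightarrow> 'v::real_vector \<Rightarrow> 'v" where
  "int_scale k v \<equiv> of_int k *\<^sub>R v"

definition int_span :: "'v::real_vector set \<Rightarrow> 'v set" where
  "int_span B = module.span int_scale B"

definition int_independent :: "'v::real_vector set \<Rightarrow> bool" where
  "int_independent B \<longleftrightarrow> \<not> module.dependent int_scale B"

definition full_rank_lattice :: "'v::real_vector set \<Rightarrow> bool" where
  "full_rank_lattice L \<longleftrightarrow> (\<exists>B. independent B \<and> span B = UNIV \<and> L = int_span B)"

definition lattice_basis :: "'v::real_vector set \<Rightarrow> 'v set \<Rightarrow> bool" where
  "lattice_basis B L \<longleftrightarrow> int_independent B \<and> int_span B = L"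

(* In what follows the family of step vectors is indexed by the finite type 'n, so that
   its size is CARD('n), and S is its coordinate matrix: row S $ l is the vector s_l. *)

definition sbar :: "real^2^'n \<Rightarrow> real" where
  "sbar S = Max (range (\<lambda>l. norm (S $ l)))"

definition psi :: "real^2^'n \<Rightarrow> real^2 \<Rightarrow> real" where
  "psi S x = 1 - (1 / real CARD('n)) * (\<Sum>l\<in>UNIV. cos ((S $ l) \<bullet> x))"

definition taylor_psi :: "real^2^'n \<Rightarrow> nat \<Rightarrow> real^2 \<Rightarrow> real" where
  "taylor_psi S m x = (1 / real CARD('n)) *
     (\<Sum>l\<in>UNIV. \<Sum>j=1..m. (-1) ^ (j + 1) * ((S $ l) \<bullet> x) ^ (2 * j) / fact (2 * j))"

definition f_inv :: "real^2^'n \<Rightarrow> real^2 \<Rightarrow> real" where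
  "f_inv S x = 1 / psi S x"

definition f_inv_taylor :: "real^2^'n \<Rightarrow> nat \<Rightarrow> real^2 \<Rightarrow> real" where
  "f_inv_taylor S m x = 1 / taylor_psi S m x"

definition mesh :: "nat \<Rightarrow> real" where
  "mesh n = 2 * pi / real n"

definition tpt :: "nat \<Rightarrow> int \<Rightarrow> real" where
  "tpt n j = 2 * pi * real_of_int j / real n"

definition xpt :: "nat \<Rightarrow> int \<Rightarrow> real" where
  "xpt n j = tpt n j - pi / real n"

definition tvec :: "nat \<Rightarrow> int \<Rightarrow> int \<Rightarrow> real^2" where
  "tvec n j k = vector [tpt n j, tpt n k]"

definition cell :: "nat \<Rightarrow> int \<Rightarrow> int \<Rightarrow> (real^2) set" where
  "cell n j k = cbox (vector [xpt n j, xpt n k]) (vector [xpt n (j + 1), xpt n (k + 1)])"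

definition Dom :: "nat \<Rightarrow> (real^2) set" where
  "Dom n = \<Union> {cell n j k | j k. tpt n j \<in> {-pi..<pi} \<and> tpt n k \<in> {-pi..<pi} \<and> tvec n j k \<noteq> 0}"

definition Dom_beta :: "real^2^'n \<Rightarrow> real \<Rightarrow> nat \<Rightarrow> (real^2) set" where
  "Dom_beta S \<beta> n = \<Union> {cell n j k | j k.
     \<bar>tpt n j\<bar> \<le> sqrt (5 * (1 - \<beta>)) / sbar S \<and> \<bar>tpt n k\<bar> \<le> sqrt (5 * (1 - \<beta>)) / sbar S
     \<and> tvec n j k \<noteq> 0}"

definition grid_sum :: "nat \<Rightarrow> (real^2) set \<Rightarrow> (real^2 \<Rightarrow> real) \<Rightarrow> real" where
  "grid_sum n A g = (\<Sum>t \<in> {tvec n j k | j k. tvec n j k \<in> A}. g t)"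

(* integral yields 0 for a non-integrable function.  This can occur only for finitely many n
   below: a truncated Taylor polynomial may vanish on Dom_beta when the cells are still large. *)

definition grid_integral :: "nat \<Rightarrow> (real^2) set \<Rightarrow> (real^2 \<Rightarrow> real) \<Rightarrow> real" where
  "grid_integral n A g = (1 / (mesh n)\<^sup>2) * integral A g"

definition F :: "nat \<Rightarrow> (real^2 \<Rightarrow> real) \<Rightarrow> real" where
  "F n g = grid_sum n (Dom n) g"

definition I :: "nat \<Rightarrow> (real^2 \<Rightarrow> real) \<Rightarrow> real" where
  "I n g = grid_integral n (Dom n) g"

definition F_beta :: "real^2^'n \<Rightarrow> real \<Rightarrow> nat \<Rightarrow> (real^2 \<Rightarrow> real) \<Rightarrow> real" where
  "F_beta S \<beta> n g = grid_sum n (Dom_beta S \<beta> n) g"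

definition I_beta :: "real^2^'n \<Rightarrow> real \<Rightarrow> nat \<Rightarrow> (real^2 \<Rightarrow> real) \<Rightarrow> real" where
  "I_beta S \<beta> n g = grid_integral n (Dom_beta S \<beta> n) g"

end

(* With Q = p_1 the quadratic part of psi, each of the functions f, f_1, f_m differs from 1/Q by a
   bounded amount on the region in question, which costs O(n^2) in the sums and in the rescaled
   integrals. Replacing 1/Q on a cell of centre t_(j,k) by its value at the centre costs
   O(n^2 / max(|j|,|k|)^3), which is summable over the lattice up to O(n^2), so everything reduces to
   the integral of 1/Q over the union of cells. The sublevel set {Q <= r} is an ellipse of area A r,
   hence the integral of 1/Q over {a < Q <= b} is A ln(b/a). The region lies between two such
   elliptic shells whose inner level is of order n^-2 and whose outer level is of order 1, so its
   integral is 2 A ln n + O(1). *)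
theory Submission
  imports Defs
begin

subsection \<open>Integrals over elliptic shells\<close>

text \<open>The estimates need a quadratic lower bound for \<open>psi\<close> and for the Taylor
  polynomials. It comes from the two basis rows alone: the lattice hypotheses force s_1 = (1,0) and
  s_2 = (0,1), so x_1 and x_2 occur among the inner products s_l . x. Other inner products may reach
  nonzero multiples of 2 pi, where 1 - cos vanishes, and contribute only their nonnegativity. The
  quartic Taylor error, divided by the product of two such quadratic bounds, is then bounded. Cells
  stick out of the prescribed square by pi/n. For n >= 2 the coordinates stay within 3 pi/2, short
  of the next zero of 1 - cos; for \<open>Dom_beta\<close> the squares (s_l . x)^2 tend to at most
  10 (1 - \<beta>), below the value 12 at which the bound y^2/2 - y^4/24 degenerates. The leading
  constant arises from A = 2 pi |\<Phi>| / sqrt(det(S^T S)): dividing 2 A ln n by the cell area 4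
  pi^2 / n^2 gives the stated coefficient.\<close>

lemma log_increments_unique:
  fixes \<phi> :: "real \<Rightarrow> real"
  assumes "0 < a" "a \<le> b" "0 \<le> A"
    and lower: "\<And>s t. a \<le> s \<Longrightarrow> s \<le> t \<Longrightarrow> t \<le> b \<Longrightarrow> A * (t - s) / t \<le> \<phi> t - \<phi> s"
    and upper: "\<And>s t. a \<le> s \<Longrightarrow> s \<le> t \<Longrightarrow> t \<le> b \<Longrightarrow> \<phi> t - \<phi> s \<le> A * (t - s) / s"
  shows "\<phi> b - \<phi> a = A * ln (b / a)"
proof -
  define D where "D = (\<lambda>t. \<phi> t - A * ln t)"
  \<comment> \<open>The increments of \<phi> and of A ln lie in the same interval
    [A (t - s)/t, A (t - s)/s]. Its length is quadratic in t - s, so their difference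
    \<open>D\<close> has derivative zero.\<close>
  have ord: "\<bar>D t - D s\<bar> \<le> A / a\<^sup>2 * (t - s)\<^sup>2" if "a \<le> s" "s \<le> t" "t \<le> b" for s t
  proof -
    have pos: "0 < s" "0 < t" using that assms by linarith+
    have "ln t - ln s \<le> (t - s) / s"
      using ln_le_minus_one[of "t / s"] pos by (simp add: ln_div field_simps)
    hence 1: "A * (ln t - ln s) \<le> A * ((t - s) / s)"
      by (intro mult_left_mono) (use assms in auto)
    have "ln s - ln t \<le> (s - t) / t"
      using ln_le_minus_one[of "s / t"] pos by (simp add: ln_div field_simps)
    hence "(t - s) / t \<le> ln t - ln s" using pos by (simp add: diff_divide_distrib)
    hence 2: "A * ((t - s) / t) \<le> A * (ln t - ln s)"
      by (intro mult_left_mono) (use assms in auto)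
    have "\<bar>D t - D s\<bar> \<le> A * ((t - s) / s) - A * ((t - s) / t)"
      using lower[OF that] upper[OF that] 1 2 by (simp add: D_def algebra_simps)
    also have "\<dots> = A * (t - s)\<^sup>2 / (s * t)"
      using pos by (simp add: field_simps power2_eq_square)
    also have "\<dots> \<le> A * (t - s)\<^sup>2 / (a * a)"
      using assms that pos by (intro divide_left_mono mult_mono mult_pos_pos) auto
    finally show ?thesis by (simp add: power2_eq_square)
  qed
  have sq: "\<bar>D t - D s\<bar> \<le> A / a\<^sup>2 * (t - s)\<^sup>2" if "s \<in> {a..b}" "t \<in> {a..b}" for s t
    using ord[of s t] ord[of t s] that
    by (cases "s \<le> t") (auto simp: abs_minus_commute power2_commute)
  have "(D has_field_derivative 0) (at s within {a..b})" if s: "s \<in> {a..b}" for s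
  proof -
    have "((\<lambda>t. A / a\<^sup>2 * \<bar>t - s\<bar>) \<longlongrightarrow> A / a\<^sup>2 * \<bar>s - s\<bar>) (at s within {a..b})"
      by (intro tendsto_intros)
    hence lim: "((\<lambda>t. A / a\<^sup>2 * \<bar>t - s\<bar>) \<longlongrightarrow> 0) (at s within {a..b})" by simp
    have "((\<lambda>t. (D t - D s) / (t - s)) \<longlongrightarrow> 0) (at s within {a..b})"
    proof (rule Lim_null_comparison[OF _ lim])
      show "\<forall>\<^sub>F t in at s within {a..b}. norm ((D t - D s) / (t - s)) \<le> A / a\<^sup>2 * \<bar>t - s\<bar>"
        unfolding eventually_at
      proof (intro exI[of _ 1] conjI ballI impI)
        fix t assume t: "t \<in> {a..b}" "t \<noteq> s \<and> dist t s < 1"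
        have "norm ((D t - D s) / (t - s)) = \<bar>D t - D s\<bar> / \<bar>t - s\<bar>" by simp
        also have "\<dots> \<le> (A / a\<^sup>2 * (t - s)\<^sup>2) / \<bar>t - s\<bar>"
          using sq[OF s t(1)] by (intro divide_right_mono) auto
        also have "\<dots> = A / a\<^sup>2 * (\<bar>t - s\<bar>\<^sup>2 / \<bar>t - s\<bar>)" by simp
        also have "\<bar>t - s\<bar>\<^sup>2 / \<bar>t - s\<bar> = \<bar>t - s\<bar>" using t by (simp add: power2_eq_square del: power2_abs abs_mult_self_eq)
        finally show "norm ((D t - D s) / (t - s)) \<le> A / a\<^sup>2 * \<bar>t - s\<bar>" .
      qed simp
    qed
    thus ?thesis by (simp add: has_field_derivative_iff)
  qed
  then obtain c where "\<forall>x\<in>{a..b}. D x = c"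
    using has_field_derivative_zero_constant[of "{a..b}" D] by auto
  hence "D a = D b" using assms by simp
  thus ?thesis using assms by (simp add: D_def ln_div algebra_simps)
qed

text \<open>A thin shell s < q <= t has measure A (t - s), and 1/q lies between 1/t and 1/s on it.
  These are the increment bounds of \<open>log_increments_unique\<close>, so no change to polar
  coordinates is needed.\<close>

lemma has_integral_inverse_shell:
  fixes q :: "'a::euclidean_space \<Rightarrow> real"
  assumes cont: "continuous_on UNIV q"
    and bdd: "\<And>r. bounded {x. q x \<le> r}"
    and meas: "\<And>r. 0 \<le> r \<Longrightarrow> measure lebesgue {x. q x \<le> r} = A * r"
    and ab: "0 < a" "a \<le> b"
  shows "((\<lambda>x. 1 / q x) has_integral A * ln (b / a)) {x. a < q x \<and> q x \<le> b}"
proof -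
  \<comment> \<open>Capping at 1/a removes the singularity at the zeros of q: \<open>g\<close> is
    continuous everywhere, hence integrable on the compact sublevel sets, and equals 1/q where q >
    a.\<close>
  define g where "g = (\<lambda>x. 1 / max a (q x))"
  define \<phi> where "\<phi> = (\<lambda>t. integral {x. q x \<le> t} g)"
  have comp: "compact {x. q x \<le> t}" for t
    using bdd cont by (auto simp: compact_eq_bounded_closed intro!: closed_Collect_le)
  have contg: "continuous_on X g" for X
    unfolding g_def using ab
    by (intro continuous_intros continuous_on_subset[OF cont]) (auto simp: max_def)
  have "g integrable_on {x. q x \<le> t}" for t
  proof -
    have "set_integrable lborel {x. q x \<le> t} g"
      unfolding set_integrable_def by (rule borel_integrable_compact[OF comp contg])
    thus ?thesis by (rule set_borel_integral_eq_integral(1))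
  qed
  hence hg: "((\<lambda>x. if q x \<le> t then g x else 0) has_integral \<phi> t) UNIV" for t
    using has_integral_restrict_UNIV[of "{x. q x \<le> t}" g "\<phi> t"]
    by (simp add: \<phi>_def integrable_integral)
  have h1: "((\<lambda>x. if q x \<le> t then 1 else 0) has_integral A * t) UNIV" if "0 \<le> t" for t
  proof -
    have "(\<lambda>x. if q x \<le> t then 1 else 0) = indicat_real {x. q x \<le> t}"
      by (auto simp: fun_eq_iff)
    thus ?thesis
      using lmeasurable_compact[OF comp[of t]] meas[OF that]
      by (simp add: lmeasurable_iff_has_integral)
  qed
  have "0 \<le> A" using meas[of 1] by (metis measure_nonneg mult.right_neutral zero_le_one)
  have "\<phi> b - \<phi> a = A * ln (b / a)"
  proof (rule log_increments_unique[OF ab \<open>0 \<le> A\<close>])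
    fix s t assume st: "a \<le> s" "s \<le> t" "t \<le> b"
    have dg: "((\<lambda>x. (if q x \<le> t then g x else 0) - (if q x \<le> s then g x else 0))
                has_integral \<phi> t - \<phi> s) UNIV"
      by (intro has_integral_diff hg)
    have d1: "((\<lambda>x. c * ((if q x \<le> t then 1 else 0) - (if q x \<le> s then 1 else 0)))
                has_integral c * (A * t - A * s)) UNIV" for c
      using st ab by (intro has_integral_mult_right has_integral_diff h1) auto
    have eq: "1 / u * (A * t - A * s) = A * (t - s) / u" for u
      by (cases "u = 0") (simp_all add: field_simps)
    have "1 / t * (A * t - A * s) \<le> \<phi> t - \<phi> s"
      by (rule has_integral_le[OF d1 dg])
        (use st ab in \<open>auto simp: g_def max_def intro!: divide_left_mono\<close>)
    thus "A * (t - s) / t \<le> \<phi> t - \<phi> s" by (simp only: eq)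
    have "\<phi> t - \<phi> s \<le> 1 / s * (A * t - A * s)"
      by (rule has_integral_le[OF dg d1])
        (use st ab in \<open>auto simp: g_def max_def intro!: divide_left_mono\<close>)
    thus "\<phi> t - \<phi> s \<le> A * (t - s) / s" by (simp only: eq)
  qed
  moreover have "((\<lambda>x. (if q x \<le> b then g x else 0) - (if q x \<le> a then g x else 0))
                has_integral \<phi> b - \<phi> a) UNIV"
    by (intro has_integral_diff hg)
  moreover have "(\<lambda>x. (if q x \<le> b then g x else 0) - (if q x \<le> a then g x else 0))
     = (\<lambda>x. if x \<in> {x. a < q x \<and> q x \<le> b} then 1 / q x else 0)"
    using ab by (auto simp: g_def fun_eq_iff)
  ultimately have "((\<lambda>x. if x \<in> {x. a < q x \<and> q x \<le> b} then 1 / q x else 0)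
      has_integral A * ln (b / a)) UNIV" by (simp only:)
  thus ?thesis by (simp only: has_integral_restrict_UNIV)
qed

text \<open>Completing the square exhibits \<open>E\<close> as a linear image of the disc of radius
  sqrt r; the area is scaled by the determinant of that map.\<close>

lemma measure_ellipse:
  fixes a b c r :: real
  assumes a: "0 < a" and d: "0 < a * c - b\<^sup>2" and r: "0 \<le> r"
  defines "E \<equiv> {x::real^2. a * (x $ 1)\<^sup>2 + 2 * b * (x $ 1) * (x $ 2) + c * (x $ 2)\<^sup>2 \<le> r}"
  shows "bounded E" and "measure lebesgue E = pi / sqrt (a * c - b\<^sup>2) * r"
proof -
  define d where "d = a * c - b\<^sup>2"
  have dp: "0 < d" using d by (simp add: d_def)
  \<comment> \<open>\<open>f\<close> solves y_1 = sqrt a (x_1 + (b/a) x_2), y_2 = x_2 / sqrt(a/d)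
    for x. It is triangular with determinant (1/sqrt a) sqrt(a/d) = 1/sqrt d.\<close>
  define f :: "real^2 \<Rightarrow> real^2" where
    "f = (\<lambda>y. vector [y $ 1 / sqrt a - b / a * sqrt (a / d) * y $ 2, sqrt (a / d) * y $ 2])"
  have f1: "f y $ 1 = y $ 1 / sqrt a - b / a * sqrt (a / d) * y $ 2" for y by (simp add: f_def)
  have f2: "f y $ 2 = sqrt (a / d) * y $ 2" for y by (simp add: f_def)
  have lin: "linear f"
    by (rule linearI; simp add: vec_eq_iff forall_2 f1 f2 algebra_simps add_divide_distrib)
  have det: "det (matrix f) = 1 / sqrt d"
    using a dp by (simp add: matrix_def det_2 f1 f2 axis_def real_sqrt_divide)
  have sq: "a * (x $ 1)\<^sup>2 + 2 * b * (x $ 1) * (x $ 2) + c * (x $ 2)\<^sup>2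
      = a * (x $ 1 + b / a * x $ 2)\<^sup>2 + d / a * (x $ 2)\<^sup>2" for x :: "real^2"
    using a by (simp add: d_def field_simps power2_eq_square)
  have nrm: "norm y \<le> sqrt r \<longleftrightarrow> (y $ 1)\<^sup>2 + (y $ 2)\<^sup>2 \<le> r" for y :: "real^2"
    using r by (simp add: norm_vec_def L2_set_def sum_2)
  have "E = f ` cball 0 (sqrt r)"
  proof (intro set_eqI iffI)
    fix x assume x: "x \<in> E"
    define y :: "real^2" where "y = vector [sqrt a * (x $ 1 + b / a * x $ 2), x $ 2 / sqrt (a / d)]"
    have "f y = x"
      using a dp by (simp add: vec_eq_iff forall_2 f1 f2 y_def)
    moreover have "(y $ 1)\<^sup>2 + (y $ 2)\<^sup>2 \<le> r"
      using x a dp unfolding E_def sq by (simp add: y_def power_mult_distrib power_divide mult.commute)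
    ultimately show "x \<in> f ` cball 0 (sqrt r)" using nrm by (auto intro!: image_eqI[of _ _ y])
  next
    fix x assume "x \<in> f ` cball 0 (sqrt r)"
    then obtain y where y: "x = f y" "(y $ 1)\<^sup>2 + (y $ 2)\<^sup>2 \<le> r" using nrm by auto
    have "a * (f y $ 1 + b / a * f y $ 2)\<^sup>2 + d / a * (f y $ 2)\<^sup>2 = (y $ 1)\<^sup>2 + (y $ 2)\<^sup>2"
      using a dp by (simp add: f1 f2 power_mult_distrib power_divide)
    thus "x \<in> E" using y unfolding E_def sq by simp
  qed
  moreover have "measure lebesgue (cball 0 (sqrt r) :: (real^2) set) = r * pi"
    using r by (simp add: content_cball unit_ball_vol_2)
  ultimately show "measure lebesgue E = pi / sqrt (a * c - b\<^sup>2) * r"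
    using dp by (simp add: measure_linear_image[OF lin] det d_def)
  show "bounded E" unfolding \<open>E = _\<close>
    using lin by (intro bounded_linear_image bounded_cball) (simp add: linear_conv_bounded_linear)
qed

subsection \<open>Cells of the grid\<close>

text \<open>\<open>P\<close> selects the admissible one-dimensional grid coordinates; both \<open>Dom\<close> and \<open>Dom_beta\<close>
  have this shape.\<close>

definition grid_index :: "(real \<Rightarrow> bool) \<Rightarrow> nat \<Rightarrow> (int \<times> int) set" where
  "grid_index P n = {(j, k). P (tpt n j) \<and> P (tpt n k) \<and> (j, k) \<noteq> (0, 0)}"

definition grid_cells :: "(real \<Rightarrow> bool) \<Rightarrow> nat \<Rightarrow> (real^2) set" where
  "grid_cells P n = (\<Union>p\<in>grid_index P n. cell n (fst p) (snd p))"

lemma tvec_nth [simp]: "tvec n j k $ 1 = tpt n j" "tvec n j k $ 2 = tpt n k"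
  by (simp_all add: tvec_def)

lemma tpt_eq_0_iff: "n \<ge> 1 \<Longrightarrow> tpt n j = 0 \<longleftrightarrow> j = 0"
  by (simp add: tpt_def)

lemma tvec_eq_0_iff: "n \<ge> 1 \<Longrightarrow> tvec n j k = 0 \<longleftrightarrow> j = 0 \<and> k = 0"
  by (simp add: vec_eq_iff forall_2 tpt_eq_0_iff)

lemma xpt_Suc: "xpt n (j + 1) = tpt n j + pi / real n"
  by (simp add: xpt_def tpt_def field_simps add_divide_distrib)

text \<open>This is why sizes are measured in \<open>infnorm\<close> below: in that norm a cell is
  the closed ball of radius pi/n around its grid point.\<close>

lemma mem_cell_iff: "x \<in> cell n j k \<longleftrightarrow> infnorm (x - tvec n j k) \<le> pi / real n"
  by (auto simp: cell_def mem_box_cart forall_2 xpt_Suc infnorm_2 abs_le_iff) (auto simp: xpt_def)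

lemma content_cell:
  assumes "n \<ge> 1"
  shows "measure lborel (cell n j k) = (mesh n)\<^sup>2"
proof -
  have "cell n j k \<noteq> {}"
    by (simp add: cell_def interval_ne_empty_cart forall_2 xpt_Suc) (simp add: xpt_def)
  thus ?thesis
    by (simp add: cell_def content_cbox_cart prod_2 UNIV_2 xpt_Suc)
      (simp add: xpt_def mesh_def power2_eq_square)
qed

lemma infnorm_tvec: "infnorm (tvec n j k) = mesh n * real_of_int (max \<bar>j\<bar> \<bar>k\<bar>)"
proof -
  have "tpt n i = mesh n * real_of_int i" for i by (simp add: tpt_def mesh_def)
  moreover have "mesh n \<ge> 0" by (simp add: mesh_def)
  ultimately show ?thesis
    by (simp add: infnorm_2 abs_mult max_mult_distrib_left of_int_max)
qed

lemma tvec_mem_cell_iff: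
  assumes "n \<ge> 1"
  shows "tvec n j k \<in> cell n j' k' \<longleftrightarrow> j = j' \<and> k = k'"
proof -
  have "\<bar>tpt n j - tpt n j'\<bar> \<le> pi / real n \<longleftrightarrow> j = j'" for j j'
  proof -
    have "tpt n j - tpt n j' = pi / real n * (2 * real_of_int (j - j'))"
      by (simp add: tpt_def algebra_simps diff_divide_distrib)
    hence "\<bar>tpt n j - tpt n j'\<bar> = pi / real n * (2 * real_of_int \<bar>j - j'\<bar>)"
      by (simp only: abs_mult of_int_abs) simp
    moreover have "pi / real n > 0" using assms by simp
    ultimately have "\<bar>tpt n j - tpt n j'\<bar> \<le> pi / real n \<longleftrightarrow> 2 * real_of_int \<bar>j - j'\<bar> \<le> 1"
      by (metis mult.right_neutral mult_le_cancel_left_pos)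
    also have "2 * real_of_int i \<le> 1 \<longleftrightarrow> i \<le> 0" for i by linarith
    finally show ?thesis by simp
  qed
  thus ?thesis by (simp add: mem_cell_iff infnorm_2)
qed

text \<open>\<open>grid_sum\<close> selects grid points by membership in a union of closed cells.
  Distinct centres differ in some coordinate by at least 2 pi/n, twice the half side, so no cell
  captures a foreign grid point and the origin stays excluded.\<close>

lemma tvec_mem_grid_cells_iff:
  assumes "n \<ge> 1"
  shows "tvec n j k \<in> grid_cells P n \<longleftrightarrow> (j, k) \<in> grid_index P n"
proof
  assume "tvec n j k \<in> grid_cells P n"
  then obtain p where "p \<in> grid_index P n" "tvec n j k \<in> cell n (fst p) (snd p)"
    by (auto simp: grid_cells_def)
  thus "(j, k) \<in> grid_index P n" using tvec_mem_cell_iff[OF assms] by simp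
next
  assume "(j, k) \<in> grid_index P n"
  moreover have "tvec n j k \<in> cell n (fst (j, k)) (snd (j, k))"
    using tvec_mem_cell_iff[OF assms] by simp
  ultimately show "tvec n j k \<in> grid_cells P n" unfolding grid_cells_def by (rule UN_I)
qed

lemma inj_tvec: "n \<ge> 1 \<Longrightarrow> inj (\<lambda>p. tvec n (fst p) (snd p))"
  by (auto simp: inj_on_def vec_eq_iff forall_2 tpt_def)

lemma grid_sum_grid_cells:
  assumes "n \<ge> 1"
  shows "grid_sum n (grid_cells P n) g = (\<Sum>p\<in>grid_index P n. g (tvec n (fst p) (snd p)))"
proof -
  have "{tvec n j k | j k. tvec n j k \<in> grid_cells P n} = (\<lambda>p. tvec n (fst p) (snd p)) ` grid_index P n"
    (is "?L = ?R")
  proof (intro equalityI subsetI)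
    fix x assume "x \<in> ?L"
    then obtain j k where "x = tvec n (fst (j, k)) (snd (j, k))" "(j, k) \<in> grid_index P n"
      using tvec_mem_grid_cells_iff[OF assms] by auto
    thus "x \<in> ?R" by (rule image_eqI)
  next
    fix x assume "x \<in> ?R"
    thus "x \<in> ?L" using tvec_mem_grid_cells_iff[OF assms] by fastforce
  qed
  thus ?thesis
    unfolding grid_sum_def
    by (simp add: sum.reindex[OF inj_on_subset[OF inj_tvec[OF assms] subset_UNIV]])
qed

lemma grid_index_subset:
  assumes "n \<ge> 1" "0 \<le> \<rho>" "\<And>t. P t \<Longrightarrow> \<bar>t\<bar> \<le> \<rho>"
  obtains K :: nat where "2 * real K + 1 \<le> (\<rho> + 1) * real n"
    "grid_index P n \<subseteq> {-int K..int K} \<times> {-int K..int K} - {(0, 0)}"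
proof
  define K where "K = nat \<lfloor>\<rho> * real n / (2 * pi)\<rfloor>"
  have "real K \<le> \<rho> * real n / (2 * pi)" using assms by (simp add: K_def)
  \<comment> \<open>Replacing pi by 1 gives 2 K <= \<rho> n; the extra 1 in 2 K + 1 is absorbed by n
    >= 1.\<close>
  also have "\<dots> \<le> \<rho> * real n / (2 * 1)"
    using assms pi_ge_two by (intro divide_left_mono) auto
  finally show "2 * real K + 1 \<le> (\<rho> + 1) * real n" using assms by (simp add: algebra_simps)
  have "\<bar>j\<bar> \<le> int K" if "P (tpt n j)" for j
  proof -
    have "real_of_int \<bar>j\<bar> \<le> \<rho> * real n / (2 * pi)"
      using assms(1) assms(3)[OF that] by (simp add: tpt_def abs_mult field_simps)
    thus ?thesis unfolding K_def by linarith
  qed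
  thus "grid_index P n \<subseteq> {-int K..int K} \<times> {-int K..int K} - {(0, 0)}"
    by (fastforce simp: grid_index_def abs_le_iff)
qed

lemma finite_grid_index:
  assumes "n \<ge> 1" "0 \<le> \<rho>" "\<And>t. P t \<Longrightarrow> \<bar>t\<bar> \<le> \<rho>"
  shows "finite (grid_index P n)"
proof -
  obtain K :: nat where
    "grid_index P n \<subseteq> {-int K..int K} \<times> {-int K..int K} - {(0, 0)}"
    using grid_index_subset[OF assms] by blast
  thus ?thesis by (rule finite_subset) auto
qed

lemma card_int_box: "card ({-int k..int k} \<times> {-int k..int k}) = (2 * k + 1)\<^sup>2"
proof -
  have "card {-int k..int k} = 2 * k + 1" by simp
  thus ?thesis by (simp only: card_cartesian_product power2_eq_square)
qed

lemma card_grid_index: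
  assumes "n \<ge> 1" "0 \<le> \<rho>" "\<And>t. P t \<Longrightarrow> \<bar>t\<bar> \<le> \<rho>"
  shows "real (card (grid_index P n)) \<le> (\<rho> + 1)\<^sup>2 * (real n)\<^sup>2"
proof -
  obtain K :: nat where K: "2 * real K + 1 \<le> (\<rho> + 1) * real n"
    "grid_index P n \<subseteq> {-int K..int K} \<times> {-int K..int K} - {(0, 0)}"
    using grid_index_subset[OF assms] .
  have "card (grid_index P n) \<le> card ({-int K..int K} \<times> {-int K..int K})"
    using K(2) by (intro card_mono) auto
  hence "real (card (grid_index P n)) \<le> real ((2 * K + 1)\<^sup>2)"
    by (simp only: card_int_box of_nat_le_iff)
  also have "\<dots> = (2 * real K + 1)\<^sup>2" by (simp add: add.commute)
  also have "\<dots> \<le> ((\<rho> + 1) * real n)\<^sup>2" using K(1) by (intro power_mono) auto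
  finally show ?thesis by (simp add: power_mult_distrib)
qed

text \<open>The square ring max(|j|,|k|) = K + 1 has 8 (K + 1) points and contributes 8/(K + 1)^2.
  This is at most 16/(K + 1) - 16/(K + 2), because K + 2 <= 2 (K + 1). The subtracted term in the
  bound makes the induction telescope.\<close>

lemma lattice_sum_bound:
  "(\<Sum>p\<in>{-int K..int K} \<times> {-int K..int K} - {(0, 0)}.
      1 / real_of_int (max \<bar>fst p\<bar> \<bar>snd p\<bar>) ^ 3) \<le> 16 - 16 / (real K + 1)"
proof (induction K)
  case 0
  have "{- int 0..int 0} \<times> {- int 0..int 0} - {(0::int, 0::int)} = {}" by auto
  thus ?case by simp
next
  case (Suc K)
  define B where "B = (\<lambda>K. {-int K..int K} \<times> {-int K..int K})"
  have sub: "B K \<subseteq> B (Suc K)" and fin: "finite (B k)" for k by (auto simp: B_def)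
  have card: "card (B k) = (2 * k + 1)\<^sup>2" for k
    by (simp only: B_def card_int_box)
  have val: "1 / real_of_int (max \<bar>fst p\<bar> \<bar>snd p\<bar>) ^ 3 = 1 / (real K + 1) ^ 3"
    if "p \<in> B (Suc K) - B K" for p
  proof -
    have "max \<bar>fst p\<bar> \<bar>snd p\<bar> = int K + 1" using that by (cases p) (auto simp: B_def)
    thus ?thesis by simp
  qed
  have "B (Suc K) - {(0,0)} = (B K - {(0,0)}) \<union> (B (Suc K) - B K)"
    using sub by (auto simp: B_def)
  hence "(\<Sum>p\<in>B (Suc K) - {(0,0)}. 1 / real_of_int (max \<bar>fst p\<bar> \<bar>snd p\<bar>) ^ 3)
     = (\<Sum>p\<in>B K - {(0,0)}. 1 / real_of_int (max \<bar>fst p\<bar> \<bar>snd p\<bar>) ^ 3)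
       + (\<Sum>p\<in>B (Suc K) - B K. 1 / real_of_int (max \<bar>fst p\<bar> \<bar>snd p\<bar>) ^ 3)"
    using fin by (simp add: sum.union_disjoint[symmetric] Diff_Int_distrib2 Int_Diff)
  also have "(\<Sum>p\<in>B (Suc K) - B K. 1 / real_of_int (max \<bar>fst p\<bar> \<bar>snd p\<bar>) ^ 3)
     = real (card (B (Suc K) - B K)) * (1 / (real K + 1) ^ 3)"
    using val by simp
  also have "card (B (Suc K) - B K) = 8 * (K + 1)"
    using sub by (simp add: card_Diff_subset[OF fin] card power2_eq_square algebra_simps)
  also have "real (8 * (K + 1)) * (1 / (real K + 1) ^ 3) = 8 / (real K + 1)\<^sup>2"
  proof -
    have "8 * x * (1 / x ^ 3) = 8 / x\<^sup>2" if "x > 0" for x :: real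
      using that by (simp add: power2_eq_square power3_eq_cube)
    from this[of "real K + 1"] show ?thesis by (simp add: algebra_simps)
  qed
  also have "\<dots> \<le> 16 / (real K + 1) - 16 / (real K + 2)"
    by (simp add: divide_simps power2_eq_square)
  finally show ?case using Suc.IH by (simp add: B_def add.commute)
qed

lemma grid_index_sum_bound:
  assumes "n \<ge> 1" "0 \<le> \<rho>" "\<And>t. P t \<Longrightarrow> \<bar>t\<bar> \<le> \<rho>"
  shows "(\<Sum>p\<in>grid_index P n. 1 / real_of_int (max \<bar>fst p\<bar> \<bar>snd p\<bar>) ^ 3) \<le> 16"
proof -
  obtain K :: nat where
    K: "grid_index P n \<subseteq> {-int K..int K} \<times> {-int K..int K} - {(0, 0)}"
    using grid_index_subset[OF assms] by blast
  have "(\<Sum>p\<in>grid_index P n. 1 / real_of_int (max \<bar>fst p\<bar> \<bar>snd p\<bar>) ^ 3)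
    \<le> (\<Sum>p\<in>{-int K..int K} \<times> {-int K..int K} - {(0, 0)}.
          1 / real_of_int (max \<bar>fst p\<bar> \<bar>snd p\<bar>) ^ 3)"
    using K by (intro sum_mono2) auto
  also have "\<dots> \<le> 16 - 16 / (real K + 1)" by (rule lattice_sum_bound)
  also have "\<dots> \<le> 16" by simp
  finally show ?thesis .
qed

text \<open>In a coordinate where the indices differ, the centres are at least two half sides apart,
  so a common point lies on a line through a side of the first cell.\<close>

lemma negligible_cell_Int:
  assumes "n \<ge> 1" "(j, k) \<noteq> (j', k')"
  shows "negligible (cell n j k \<inter> cell n j' k')"
proof -
  have close: "u = xpt n (i + 1) \<or> u = xpt n i"
    if u: "\<bar>u - tpt n i\<bar> \<le> pi / real n" "\<bar>u - tpt n i'\<bar> \<le> pi / real n" and "i \<noteq> i'" for u i i'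
  proof -
    have eq1: "u = a + d" if "d * (2 * 1) \<le> a' - a" "\<bar>u - a\<bar> \<le> d" "\<bar>u - a'\<bar> \<le> d"
      for a a' d :: real using that by linarith
    have eq2: "u = a - d" if "a' - a \<le> d * (2 * (-1))" "\<bar>u - a\<bar> \<le> d" "\<bar>u - a'\<bar> \<le> d"
      for a a' d :: real using that by linarith
    have "pi / real n > 0" using assms by simp
    have *: "tpt n i' - tpt n i = pi / real n * (2 * real_of_int (i' - i))" for i i'
      by (simp add: tpt_def algebra_simps diff_divide_distrib)
    consider "i' - i \<ge> 1" | "i' - i \<le> -1" using \<open>i \<noteq> i'\<close> by linarith
    thus ?thesis
    proof cases
      case 1
      hence "pi / real n * (2 * 1) \<le> tpt n i' - tpt n i"
        unfolding * using \<open>pi / real n > 0\<close> by (intro mult_left_mono) auto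
      hence "u = xpt n (i + 1)" using eq1 u unfolding xpt_Suc by blast
      thus ?thesis ..
    next
      case 2
      hence "tpt n i' - tpt n i \<le> pi / real n * (2 * (-1))"
        unfolding * using \<open>pi / real n > 0\<close> by (intro mult_left_mono) auto
      hence "u = xpt n i" using eq2 u unfolding xpt_def by blast
      thus ?thesis ..
    qed
  qed
  have "cell n j k \<inter> cell n j' k' \<subseteq>
      {x :: real^2. x $ 1 = xpt n (j + 1)} \<union> {x :: real^2. x $ 1 = xpt n j} \<union>
      {x :: real^2. x $ 2 = xpt n (k + 1)} \<union> {x :: real^2. x $ 2 = xpt n k}"
  proof
    fix x assume "x \<in> cell n j k \<inter> cell n j' k'"
    hence x: "\<bar>x $ 1 - tpt n j\<bar> \<le> pi / real n" "\<bar>x $ 1 - tpt n j'\<bar> \<le> pi / real n"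
      "\<bar>x $ 2 - tpt n k\<bar> \<le> pi / real n" "\<bar>x $ 2 - tpt n k'\<bar> \<le> pi / real n"
      by (auto simp: mem_cell_iff infnorm_2)
    consider "j \<noteq> j'" | "k \<noteq> k'" using assms(2) by auto
    thus "x \<in> {x :: real^2. x $ 1 = xpt n (j + 1)} \<union> {x :: real^2. x $ 1 = xpt n j} \<union>
      {x :: real^2. x $ 2 = xpt n (k + 1)} \<union> {x :: real^2. x $ 2 = xpt n k}"
      by cases (use close[OF x(1,2)] close[OF x(3,4)] in auto)
  qed
  moreover have hyp: "negligible {x :: real^2. x $ i = c}" for i c
    using negligible_standard_hyperplane[of "axis i 1 :: real^2" c] by (simp add: inner_axis)
  have "negligible ({x :: real^2. x $ 1 = xpt n (j + 1)} \<union> {x :: real^2. x $ 1 = xpt n j} \<union>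
      {x :: real^2. x $ 2 = xpt n (k + 1)} \<union> {x :: real^2. x $ 2 = xpt n k})"
    by (intro negligible_Un hyp)
  ultimately show ?thesis using negligible_subset by metis
qed

lemma has_integral_grid_cells:
  fixes g :: "real^2 \<Rightarrow> real"
  assumes "n \<ge> 1" "finite (grid_index P n)" "continuous_on (grid_cells P n) g"
  shows "(g has_integral (\<Sum>p\<in>grid_index P n. integral (cell n (fst p) (snd p)) g)) (grid_cells P n)"
  unfolding grid_cells_def
proof (rule has_integral_UN)
  fix p assume "p \<in> grid_index P n"
  hence "continuous_on (cell n (fst p) (snd p)) g"
    by (intro continuous_on_subset[OF assms(3)]) (auto simp: grid_cells_def)
  thus "(g has_integral integral (cell n (fst p) (snd p)) g) (cell n (fst p) (snd p))"
    unfolding cell_def by (intro integrable_integral integrable_continuous)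
qed (use assms in \<open>auto simp: pairwise_def intro!: negligible_cell_Int\<close>)

text \<open>A cell has area \<open>(mesh n)\<^sup>2\<close>, so the rescaled integral over it is the
  average of g there and inherits any bound on the deviation from a constant.\<close>

lemma grid_integral_minus_sum:
  assumes "n \<ge> 1" "finite (grid_index P n)" "continuous_on (grid_cells P n) g"
    and close: "\<And>j k x. (j, k) \<in> grid_index P n \<Longrightarrow> x \<in> cell n j k \<Longrightarrow> \<bar>g x - c (j, k)\<bar> \<le> B (j, k)"
  shows "\<bar>grid_integral n (grid_cells P n) g - (\<Sum>p\<in>grid_index P n. c p)\<bar>
    \<le> (\<Sum>p\<in>grid_index P n. B p)"
proof -
  have mesh: "mesh n > 0" using assms by (simp add: mesh_def)
  have "integral (grid_cells P n) g = (\<Sum>p\<in>grid_index P n. integral (cell n (fst p) (snd p)) g)"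
    by (rule integral_unique[OF has_integral_grid_cells[OF assms(1-3)]])
  hence "grid_integral n (grid_cells P n) g - (\<Sum>p\<in>grid_index P n. c p)
     = (\<Sum>p\<in>grid_index P n. 1 / (mesh n)\<^sup>2 * integral (cell n (fst p) (snd p)) g - c p)"
    by (simp add: grid_integral_def sum_subtractf sum_divide_distrib)
  also have "\<bar>\<dots>\<bar> \<le> (\<Sum>p\<in>grid_index P n. B p)"
  proof (rule order_trans[OF sum_abs sum_mono])
    fix p assume p: "p \<in> grid_index P n"
    obtain j k where jk: "p = (j, k)" by (cases p)
    have "tvec n j k \<in> cell n j k" using assms(1) by (simp add: tvec_mem_cell_iff)
    \<comment> \<open>Nonnegativity comes from the deviation bound itself, evaluated at the centre
      of the cell.\<close>
    hence B: "0 \<le> B (j, k)" using close[of j k "tvec n j k"] p jk by fastforce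
    have cont: "continuous_on (cell n j k) g"
      using p jk by (intro continuous_on_subset[OF assms(3)]) (auto simp: grid_cells_def)
    have ig: "(g has_integral integral (cell n j k) g) (cell n j k)"
      using cont unfolding cell_def by (intro integrable_integral integrable_continuous)
    have "((\<lambda>x. g x - c p) has_integral
        integral (cell n j k) g - measure lborel (cell n j k) *\<^sub>R c p) (cell n j k)"
      by (intro has_integral_diff ig) (simp only: cell_def has_integral_const)
    hence "norm (integral (cell n j k) g - measure lborel (cell n j k) *\<^sub>R c p)
        \<le> B (j, k) * measure lborel (cell n j k)"
      using has_integral_bound[OF B] close p jk unfolding cell_def by (metis real_norm_def)
    hence "\<bar>integral (cell n j k) g - (mesh n)\<^sup>2 * c p\<bar> \<le> B p * (mesh n)\<^sup>2"
      by (simp add: content_cell[OF assms(1)] jk)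
    hence "\<bar>integral (cell n j k) g - (mesh n)\<^sup>2 * c p\<bar> / (mesh n)\<^sup>2 \<le> B p"
      using mesh by (simp add: divide_simps)
    also have "\<bar>integral (cell n j k) g - (mesh n)\<^sup>2 * c p\<bar> / (mesh n)\<^sup>2
      = \<bar>(integral (cell n j k) g - (mesh n)\<^sup>2 * c p) / (mesh n)\<^sup>2\<bar>" by simp
    also have "(integral (cell n j k) g - (mesh n)\<^sup>2 * c p) / (mesh n)\<^sup>2
      = 1 / (mesh n)\<^sup>2 * integral (cell n j k) g - c p"
      using mesh by (simp add: field_simps)
    finally show "\<bar>1 / (mesh n)\<^sup>2 * integral (cell n (fst p) (snd p)) g - c p\<bar> \<le> B p"
      by (simp add: jk)
  qed
  finally show ?thesis .
qed

lemma infnorm_tvec_ge: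
  assumes "n \<ge> 1" "(j, k) \<noteq> (0, 0)"
  shows "mesh n \<le> infnorm (tvec n j k)"
proof -
  have "1 \<le> max \<bar>j\<bar> \<bar>k\<bar>" using assms(2) by auto
  hence "mesh n * 1 \<le> mesh n * real_of_int (max \<bar>j\<bar> \<bar>k\<bar>)"
    by (intro mult_left_mono) (auto simp: mesh_def)
  thus ?thesis by (simp add: infnorm_tvec)
qed

text \<open>A nonzero centre has norm at least \<open>mesh n\<close>, while a point of its cell is
  at most half of that away, so both norms are comparable uniformly in n.\<close>

lemma infnorm_cell:
  assumes "n \<ge> 1" "(j, k) \<noteq> (0, 0)" "x \<in> cell n j k"
  shows "infnorm (tvec n j k) / 2 \<le> infnorm x" and "infnorm x \<le> 2 * infnorm (tvec n j k)"
proof -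
  have "\<bar>infnorm x - infnorm (tvec n j k)\<bar> \<le> mesh n / 2"
    using absdiff_infnorm[of x "tvec n j k"] assms(3) by (simp add: mem_cell_iff mesh_def)
  with infnorm_tvec_ge[OF assms(1,2)]
  show "infnorm (tvec n j k) / 2 \<le> infnorm x" "infnorm x \<le> 2 * infnorm (tvec n j k)"
    by linarith+
qed

lemma infnorm_grid_cells:
  assumes "n \<ge> 1" "\<And>t. P t \<Longrightarrow> \<bar>t\<bar> \<le> \<rho>" "x \<in> grid_cells P n"
  shows "pi / real n \<le> infnorm x" and "infnorm x \<le> \<rho> + pi / real n"
proof -
  obtain j k where jk: "P (tpt n j)" "P (tpt n k)" "(j, k) \<noteq> (0, 0)" "x \<in> cell n j k"
    using assms(3) by (auto simp: grid_cells_def grid_index_def)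
  show "pi / real n \<le> infnorm x"
    using infnorm_cell(1)[OF assms(1) jk(3,4)] infnorm_tvec_ge[OF assms(1) jk(3)]
    by (simp add: mesh_def)
  have "\<bar>infnorm x - infnorm (tvec n j k)\<bar> \<le> pi / real n"
    using absdiff_infnorm[of x "tvec n j k"] jk(4) by (simp add: mem_cell_iff)
  moreover have "infnorm (tvec n j k) \<le> \<rho>"
    using assms(2)[OF jk(1)] assms(2)[OF jk(2)] by (simp add: infnorm_2)
  ultimately show "infnorm x \<le> \<rho> + pi / real n" by linarith
qed

text \<open>Rounding each coordinate to the nearest index yields a cell containing x. The lower
  bound on \<open>infnorm x\<close> rules out the missing central cell, the upper one keeps the
  rounded coordinates admissible.\<close>

lemma grid_cells_memI:
  assumes "n \<ge> 1" "\<And>t. \<bar>t\<bar> < r \<Longrightarrow> P t"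
    and "pi / real n < infnorm x" "infnorm x + pi / real n < r"
  shows "x \<in> grid_cells P n"
proof -
  define J where "J = (\<lambda>u. round (u * real n / (2 * pi)))"
  have near: "\<bar>u - tpt n (J u)\<bar> \<le> pi / real n" for u
  proof -
    have "\<bar>u - tpt n (J u)\<bar> = 2 * pi / real n * \<bar>u * real n / (2 * pi) - of_int (J u)\<bar>"
    proof -
      have "u - tpt n (J u) = 2 * pi / real n * (u * real n / (2 * pi) - of_int (J u))"
        using assms(1) by (simp add: tpt_def right_diff_distrib)
      thus ?thesis by (simp only: abs_mult) simp
    qed
    also have "\<dots> \<le> 2 * pi / real n * (1 / 2)"
      using of_int_round_abs_le[of "u * real n / (2 * pi)"] assms(1)
      by (intro mult_left_mono) (auto simp: J_def abs_minus_commute)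
    finally show ?thesis by simp
  qed
  have cell: "x \<in> cell n (J (x $ 1)) (J (x $ 2))"
    using near[of "x $ 1"] near[of "x $ 2"] by (simp add: mem_cell_iff infnorm_2)
  have "(J (x $ 1), J (x $ 2)) \<noteq> (0, 0)"
  proof
    assume "(J (x $ 1), J (x $ 2)) = (0, 0)"
    hence "infnorm x \<le> pi / real n"
      using near[of "x $ 1"] near[of "x $ 2"] by (simp add: infnorm_2 tpt_def)
    thus False using assms(3) by simp
  qed
  moreover have "P (tpt n (J (x $ i)))" for i
    using near[of "x $ i"] assms(4) component_le_infnorm_cart[of x i] by (intro assms(2)) linarith
  ultimately show ?thesis using cell by (auto simp: grid_cells_def grid_index_def)
qed

lemma Union_cells:
  assumes n: "n \<ge> 1"
  shows "\<Union> {cell n j k | j k. P (tpt n j) \<and> P (tpt n k) \<and> tvec n j k \<noteq> 0} = grid_cells P n"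
    (is "\<Union> ?L = _")
proof -
  have "?L = (\<lambda>p. cell n (fst p) (snd p)) ` grid_index P n" (is "_ = ?R")
  proof (intro equalityI subsetI)
    fix X assume "X \<in> ?L"
    then obtain j k where "X = cell n (fst (j, k)) (snd (j, k))" "(j, k) \<in> grid_index P n"
      using tvec_eq_0_iff[OF n] by (auto simp: grid_index_def)
    thus "X \<in> ?R" by (rule image_eqI)
  next
    fix X assume "X \<in> ?R"
    then obtain j k where "X = cell n j k" "(j, k) \<in> grid_index P n" by auto
    thus "X \<in> ?L" using tvec_eq_0_iff[OF n, of j k] by (auto simp: grid_index_def)
  qed
  thus ?thesis by (simp add: grid_cells_def)
qed

lemma Dom_eq_grid_cells: "n \<ge> 1 \<Longrightarrow> Dom n = grid_cells (\<lambda>t. t \<in> {-pi..<pi}) n"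
  unfolding Dom_def by (rule Union_cells)

lemma Dom_beta_eq_grid_cells:
  "n \<ge> 1 \<Longrightarrow> Dom_beta S \<beta> n = grid_cells (\<lambda>t. \<bar>t\<bar> \<le> sqrt (5 * (1 - \<beta>)) / sbar S) n"
  unfolding Dom_beta_def by (rule Union_cells)

subsection \<open>Bounds for the cosine and its Taylor polynomials\<close>

text \<open>The upper bound is 1 - cos y = 2 sin^2(y/2); the lower one is the Maclaurin formula of
  order 4, whose remainder has a cosine factor of at most 1.\<close>

lemma one_minus_cos_bounds:
  fixes y :: real
  shows "1 - cos y \<le> y\<^sup>2 / 2" "y\<^sup>2 / 2 - y ^ 4 / 24 \<le> 1 - cos y"
proof -
  obtain t where "cos y = (\<Sum>m<4. cos_coeff m * y ^ m) + (cos (t + 1/2 * real 4 * pi) / fact 4) * y ^ 4"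
    using Maclaurin_cos_expansion[of y 4] by blast
  hence eq: "cos y = 1 - y\<^sup>2 / 2 + cos (t + 1/2 * real 4 * pi) * (y ^ 4 / 24)"
  proof -
    have "(\<Sum>m<4. h m) = h 0 + h 1 + h 2 + h 3" for h :: "nat \<Rightarrow> real"
      by (simp add: eval_nat_numeral)
    moreover have "cos_coeff 0 = 1" "cos_coeff 1 = 0" "cos_coeff 2 = - 1 / 2" "cos_coeff 3 = 0"
      by (simp_all add: cos_coeff_def fact_numeral)
    moreover have "fact 4 = (24 :: real)" by (simp add: fact_numeral)
    ultimately show ?thesis
      using \<open>cos y = (\<Sum>m<4. cos_coeff m * y ^ m) + _\<close> by simp
  qed
  have "cos (t + 1/2 * real 4 * pi) * (y ^ 4 / 24) \<le> 1 * (y ^ 4 / 24)"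
    by (intro mult_right_mono) auto
  thus "y\<^sup>2 / 2 - y ^ 4 / 24 \<le> 1 - cos y" using eq by linarith
  have "\<bar>sin (y / 2)\<bar>\<^sup>2 \<le> \<bar>y / 2\<bar>\<^sup>2" by (intro power_mono abs_sin_x_le_abs_x) auto
  thus "1 - cos y \<le> y\<^sup>2 / 2"
    using cos_double_sin[of "y / 2"] by (simp add: power_divide)
qed

text \<open>After the first term is split off, the rest is the negated alternating sum of the
  shifted sequence, which lies between 0 and \<open>a 1\<close>; hence the generalization over
  \<open>a\<close>.\<close>

lemma alternating_sum_bounds:
  fixes a :: "nat \<Rightarrow> real"
  assumes "\<And>j. 0 \<le> a j" "\<And>j. a (Suc j) \<le> a j"
  shows "0 \<le> (\<Sum>j<m. (-1) ^ j * a j) \<and> (\<Sum>j<m. (-1) ^ j * a j) \<le> a 0"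
  using assms
proof (induction m arbitrary: a)
  case (Suc m)
  have "(\<Sum>j<Suc m. (-1) ^ j * a j) = a 0 - (\<Sum>j<m. (-1) ^ j * a (Suc j))"
    by (simp only: sum.lessThan_Suc_shift) (simp add: sum_negf)
  with Suc.IH[of "\<lambda>j. a (Suc j)"] Suc.prems show ?case
    by (smt (verit, best))
qed simp

definition taylor_term_sum :: "nat \<Rightarrow> real \<Rightarrow> real" where
  "taylor_term_sum m y = (\<Sum>j=1..m. (-1) ^ (j + 1) * y ^ (2 * j) / fact (2 * j))"

text \<open>The condition y^2 <= 12 makes the terms y^(2j)/(2j)! decrease from j = 1 on, since the
  first ratio is y^2/(3*4). What follows the leading term is then an alternating sum between 0 and
  y^4/24, for every m.\<close>

lemma taylor_term_sum_bounds:
  assumes "y\<^sup>2 \<le> 12" "m \<ge> 1"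
  shows "taylor_term_sum m y \<le> y\<^sup>2 / 2" "y\<^sup>2 / 2 - y ^ 4 / 24 \<le> taylor_term_sum m y"
proof -
  define a where "a = (\<lambda>j. y ^ (2 * (j + 1)) / fact (2 * (j + 1)))"
  have nonneg: "0 \<le> a j" for j unfolding a_def by (intro divide_nonneg_nonneg zero_le_even_power) auto
  have dec: "a (Suc j) \<le> a j" for j
  proof -
    have "a (Suc j) = a j * (y\<^sup>2 / ((2 * real j + 3) * (2 * real j + 4)))"
      by (simp add: a_def power2_eq_square algebra_simps)
    also have "\<dots> \<le> a j * 1"
    proof (intro mult_left_mono nonneg)
      have "3 * 4 \<le> (2 * real j + 3) * (2 * real j + 4)" by (intro mult_mono) auto
      thus "y\<^sup>2 / ((2 * real j + 3) * (2 * real j + 4)) \<le> 1" using assms(1) by simp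
    qed
    finally show ?thesis by simp
  qed
  obtain m' where m': "m = Suc m'" using assms(2) by (cases m) auto
  have "taylor_term_sum m y = (\<Sum>j<m. (-1) ^ j * a j)"
    unfolding taylor_term_sum_def a_def
    by (simp add: sum.atLeast1_atMost_eq)
  also have "\<dots> = a 0 - (\<Sum>j<m'. (-1) ^ j * a (Suc j))"
    unfolding m' by (simp only: sum.lessThan_Suc_shift) (simp add: sum_negf)
  finally have eq: "taylor_term_sum m y = a 0 - (\<Sum>j<m'. (-1) ^ j * a (Suc j))" .
  have "a 0 = y\<^sup>2 / 2" "a 1 = y ^ 4 / 24" by (simp_all add: a_def fact_numeral power2_eq_square power4_eq_xxxx)
  thus "taylor_term_sum m y \<le> y\<^sup>2 / 2" "y\<^sup>2 / 2 - y ^ 4 / 24 \<le> taylor_term_sum m y"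
    using eq alternating_sum_bounds[of "\<lambda>j. a (Suc j)" m', OF nonneg dec] by simp_all
qed

text \<open>For y^2 <= 11 the factor 1/2 - y^2/24 is at least 1/24. At 12 it would vanish, so 11
  leaves a margin on that side and, on the other, above the 10 coming from the truncation
  radius.\<close>

lemma quartic_lower_bound:
  fixes y :: real
  assumes "y\<^sup>2 \<le> 11"
  shows "y\<^sup>2 / 36 \<le> y\<^sup>2 / 2 - y ^ 4 / 24"
proof -
  have "y\<^sup>2 * y\<^sup>2 \<le> y\<^sup>2 * 11" using assms by (intro mult_left_mono) auto
  moreover have "y ^ 4 = y\<^sup>2 * y\<^sup>2" by (simp add: power2_eq_square power4_eq_xxxx mult.assoc)
  ultimately show ?thesis using zero_le_power2[of y] by linarith
qed

lemma abs_diff_inverse: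
  fixes a b :: real
  assumes "0 < a" "0 < b"
  shows "\<bar>1 / a - 1 / b\<bar> = \<bar>b - a\<bar> / (a * b)"
proof -
  have "1 / a - 1 / b = (b - a) / (a * b)" using assms by (simp add: diff_frac_eq)
  thus ?thesis using assms by (simp add: abs_mult)
qed

text \<open>The factor 1/36 is small enough for two regimes: the quartic Taylor bound works for
  y^2 \<le> 11, and beyond that cos y \<le> 0 while y^2 \<le> 36.\<close>

lemma one_minus_cos_ge:
  fixes y :: real
  assumes "\<bar>y\<bar> \<le> 3 * pi / 2"
  shows "y\<^sup>2 / 36 \<le> 1 - cos y"
proof (cases "y\<^sup>2 \<le> 11")
  case True
  thus ?thesis using quartic_lower_bound one_minus_cos_bounds(2)[of y] by fastforce
next
  case False
  have "2 < \<bar>y\<bar>" by (rule power2_less_imp_less) (use False in auto)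
  hence "pi / 2 \<le> \<bar>y\<bar>" using pi_less_4 by linarith
  hence "0 \<le> cos (\<bar>y\<bar> - pi)" using assms by (intro cos_ge_zero) linarith+
  hence "cos y \<le> 0" by (simp add: cos_diff)
  have "\<bar>y\<bar> \<le> 6" using assms pi_less_4 by linarith
  hence "\<bar>y\<bar>\<^sup>2 \<le> 6\<^sup>2" by (intro power_mono) auto
  thus ?thesis using \<open>cos y \<le> 0\<close> by simp
qed

lemma taylor_psi_eq:
  "taylor_psi S m x = (1 / real CARD('n)) * (\<Sum>l\<in>UNIV. taylor_term_sum m (S $ l \<bullet> x))"
  for S :: "real^2^'n::finite"
  by (simp add: taylor_psi_def taylor_term_sum_def)

text \<open>The member of \<open>H\<close> may change with n, so f need not eventually equal any
  single one; it is dominated by the sum of the absolute values of all of them.\<close>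

lemma bigo_pointwise_member:
  fixes g :: "nat \<Rightarrow> real"
  assumes fin: "finite H" and H: "\<And>h. h \<in> H \<Longrightarrow> h \<in> O(g)"
    and mem: "\<And>n. n \<ge> 1 \<Longrightarrow> \<exists>h\<in>H. f n = h n"
  shows "f \<in> O(g)"
proof (rule landau_o.big_trans)
  show "f \<in> O(\<lambda>n. \<Sum>h\<in>H. \<bar>h n\<bar> :: real)"
  proof (rule bigoI[OF eventually_mono[OF eventually_ge_at_top[of 1]]])
    fix n :: nat assume "n \<ge> 1"
    then obtain h where h: "h \<in> H" "f n = h n" using mem by blast
    have "\<bar>h n\<bar> \<le> (\<Sum>h\<in>H. \<bar>h n\<bar>)" using fin h(1) by (intro member_le_sum) auto
    thus "norm (f n) \<le> 1 * norm (\<Sum>h\<in>H. \<bar>h n\<bar>)" using h(2) by simp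
  qed
  show "(\<lambda>n. \<Sum>h\<in>H. \<bar>h n\<bar>) \<in> O(g)"
    using H by (intro big_sum_in_bigo) simp
qed

lemma bigo_cong_ge_1:
  fixes f g :: "nat \<Rightarrow> real"
  assumes "f \<in> O(h)" "\<And>n. n \<ge> 1 \<Longrightarrow> g n = f n"
  shows "g \<in> O(h)"
proof -
  have "eventually (\<lambda>n. f n = g n) at_top"
    using assms(2) by (intro eventually_mono[OF eventually_ge_at_top[of 1]]) simp
  thus ?thesis using assms(1) landau_o.big.in_cong by blast
qed

subsection \<open>Comparison with the quadratic form\<close>

text \<open>The two unit rows put \<open>x $ 1\<close> and \<open>x $ 2\<close> among the inner
  products, which bounds \<open>quad\<close> below by a multiple of the squared norm.\<close>

locale step_vectors =
  fixes S :: "real^2^'n::finite" and i1 i2 :: 'n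
  assumes S_basis: "S $ i1 $ 1 = 1" "S $ i1 $ 2 = 0" "S $ i2 $ 1 = 0" "S $ i2 $ 2 = 1"
begin

definition quad :: "real^2 \<Rightarrow> real" where
  "quad x = (\<Sum>l\<in>UNIV. (S $ l \<bullet> x)\<^sup>2) / (2 * real CARD('n))"

lemma inner_basis: "S $ i1 \<bullet> x = x $ 1" "S $ i2 \<bullet> x = x $ 2"
  by (simp_all add: inner_vec_def sum_2 S_basis)

lemma taylor_psi_1: "taylor_psi S 1 = quad"
  by (simp add: fun_eq_iff taylor_psi_def quad_def fact_numeral numeral_2_eq_2 flip: sum_divide_distrib)

lemma norm_row_le: "norm (S $ l) \<le> sbar S"
  by (simp add: sbar_def)

lemma sbar_ge_1: "1 \<le> sbar S"
proof -
  have "norm (S $ i1) = 1" by (simp add: norm_vec_def L2_set_def sum_2 S_basis)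
  thus ?thesis using norm_row_le[of i1] by simp
qed

text \<open>Cauchy-Schwarz, with the factor 2 from passing from the Euclidean norm to
  \<open>infnorm\<close> in the plane. This 2 turns the 5 of the truncation radius into 10.\<close>

lemma sq_inner_le: "(S $ l \<bullet> x)\<^sup>2 \<le> 2 * (sbar S)\<^sup>2 * (infnorm x)\<^sup>2"
proof -
  have "\<bar>S $ l \<bullet> x\<bar> \<le> norm (S $ l) * norm x" by (rule Cauchy_Schwarz_ineq2)
  also have "\<dots> \<le> sbar S * (sqrt 2 * infnorm x)"
    using norm_row_le norm_le_infnorm[of x] sbar_ge_1 by (intro mult_mono) auto
  finally have "\<bar>S $ l \<bullet> x\<bar>\<^sup>2 \<le> (sbar S * (sqrt 2 * infnorm x))\<^sup>2" by (intro power_mono) auto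
  thus ?thesis by (simp add: power_mult_distrib mult_ac)
qed

lemma sum_ge_basis:
  fixes h :: "'n \<Rightarrow> real"
  assumes "\<And>l. 0 \<le> h l"
  shows "h i1 + h i2 \<le> (\<Sum>l\<in>UNIV. h l)"
proof -
  have "i1 \<noteq> i2" using S_basis by auto
  hence "h i1 + h i2 = (\<Sum>l\<in>{i1, i2}. h l)" by simp
  also have "\<dots> \<le> (\<Sum>l\<in>UNIV. h l)" using assms by (intro sum_mono2) auto
  finally show ?thesis .
qed

lemma sum_UNIV_le:
  fixes h :: "'n \<Rightarrow> real"
  assumes "\<And>l. h l \<le> K"
  shows "(\<Sum>l\<in>UNIV. h l) \<le> real CARD('n) * K"
  using sum_mono[of "UNIV :: 'n set" h "\<lambda>_. K"] assms by simp

lemma infnorm_sq_le: "(infnorm (x :: real^2))\<^sup>2 \<le> (x $ 1)\<^sup>2 + (x $ 2)\<^sup>2"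
  by (simp add: infnorm_2 max_def)

lemma quad_ge: "(infnorm x)\<^sup>2 / (2 * real CARD('n)) \<le> quad x"
proof -
  have "(infnorm x)\<^sup>2 \<le> (\<Sum>l\<in>UNIV. (S $ l \<bullet> x)\<^sup>2)"
    using infnorm_sq_le[of x] sum_ge_basis[of "\<lambda>l. (S $ l \<bullet> x)\<^sup>2"] by (simp add: inner_basis)
  thus ?thesis by (simp add: quad_def divide_right_mono)
qed

lemma quad_pos: "x \<noteq> 0 \<Longrightarrow> 0 < quad x"
  by (rule less_le_trans[OF _ quad_ge]) (simp add: infnorm_eq_0)

lemma quad_le: "quad x \<le> (sbar S)\<^sup>2 * (infnorm x)\<^sup>2"
proof -
  have "(\<Sum>l\<in>UNIV. (S $ l \<bullet> x)\<^sup>2) \<le> real CARD('n) * (2 * (sbar S)\<^sup>2 * (infnorm x)\<^sup>2)"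
    by (intro sum_UNIV_le sq_inner_le)
  thus ?thesis by (simp add: quad_def field_simps)
qed

lemma abs_inner_le: "\<bar>S $ l \<bullet> x\<bar> \<le> sqrt 2 * sbar S * infnorm x"
proof (rule power2_le_imp_le)
  show "\<bar>S $ l \<bullet> x\<bar>\<^sup>2 \<le> (sqrt 2 * sbar S * infnorm x)\<^sup>2"
    using sq_inner_le[of l x] by (simp add: power_mult_distrib)
  show "0 \<le> sqrt 2 * sbar S * infnorm x" using sbar_ge_1 by (simp add: infnorm_pos_le)
qed

text \<open>Each difference of squares factors as (s . (x - y)) (s . (x + y)): one factor has the
  size of the displacement, the other that of the points.\<close>

lemma quad_diff:
  "\<bar>quad x - quad y\<bar> \<le> (sbar S)\<^sup>2 * infnorm (x - y) * (infnorm x + infnorm y)"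
proof -
  have "\<bar>(S $ l \<bullet> x)\<^sup>2 - (S $ l \<bullet> y)\<^sup>2\<bar> \<le> 2 * ((sbar S)\<^sup>2 * infnorm (x - y) * (infnorm x + infnorm y))"
    for l
  proof -
    have "(S $ l \<bullet> x)\<^sup>2 - (S $ l \<bullet> y)\<^sup>2 = (S $ l \<bullet> (x - y)) * (S $ l \<bullet> (x + y))"
      by (simp add: inner_diff_right inner_add_right power2_eq_square algebra_simps)
    hence "\<bar>(S $ l \<bullet> x)\<^sup>2 - (S $ l \<bullet> y)\<^sup>2\<bar> = \<bar>S $ l \<bullet> (x - y)\<bar> * \<bar>S $ l \<bullet> (x + y)\<bar>"
      by (simp add: abs_mult)
    also have "\<dots> \<le> (sqrt 2 * sbar S * infnorm (x - y)) * (sqrt 2 * sbar S * (infnorm x + infnorm y))"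
    proof (intro mult_mono abs_inner_le)
      have "\<bar>S $ l \<bullet> (x + y)\<bar> \<le> sqrt 2 * sbar S * infnorm (x + y)" by (rule abs_inner_le)
      also have "\<dots> \<le> sqrt 2 * sbar S * (infnorm x + infnorm y)"
        using sbar_ge_1 by (intro mult_left_mono infnorm_triangle) auto
      finally show "\<bar>S $ l \<bullet> (x + y)\<bar> \<le> sqrt 2 * sbar S * (infnorm x + infnorm y)" .
    qed (use sbar_ge_1 in \<open>auto simp: infnorm_pos_le\<close>)
    also have "\<dots> = (sqrt 2)\<^sup>2 * ((sbar S)\<^sup>2 * infnorm (x - y) * (infnorm x + infnorm y))"
      by (simp only: power2_eq_square mult_ac)
    finally show ?thesis by simp
  qed
  hence "(\<Sum>l\<in>UNIV. \<bar>(S $ l \<bullet> x)\<^sup>2 - (S $ l \<bullet> y)\<^sup>2\<bar>)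
      \<le> real CARD('n) * (2 * ((sbar S)\<^sup>2 * infnorm (x - y) * (infnorm x + infnorm y)))"
    by (rule sum_UNIV_le)
  moreover have "quad x - quad y = (\<Sum>l\<in>UNIV. (S $ l \<bullet> x)\<^sup>2 - (S $ l \<bullet> y)\<^sup>2) / (2 * real CARD('n))"
    by (simp add: quad_def sum_subtractf diff_divide_distrib)
  ultimately have "\<bar>(quad x - quad y) * (2 * real CARD('n))\<bar>
      \<le> real CARD('n) * (2 * ((sbar S)\<^sup>2 * infnorm (x - y) * (infnorm x + infnorm y)))"
    using order_trans[OF sum_abs[of "\<lambda>l. (S $ l \<bullet> x)\<^sup>2 - (S $ l \<bullet> y)\<^sup>2" UNIV]] by simp
  thus ?thesis by (simp add: abs_mult mult_ac)
qed

lemma continuous_on_quad: "continuous_on X quad"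
  unfolding quad_def by (intro continuous_intros) auto

section \<open>Coefficients and discriminant of the quadratic form\<close>

definition coeff_a :: real where "coeff_a = (\<Sum>l\<in>UNIV. (S $ l $ 1)\<^sup>2) / (2 * real CARD('n))"
definition coeff_b :: real where "coeff_b = (\<Sum>l\<in>UNIV. S $ l $ 1 * S $ l $ 2) / (2 * real CARD('n))"
definition coeff_c :: real where "coeff_c = (\<Sum>l\<in>UNIV. (S $ l $ 2)\<^sup>2) / (2 * real CARD('n))"

lemma quad_form:
  "quad x = coeff_a * (x $ 1)\<^sup>2 + 2 * coeff_b * (x $ 1) * (x $ 2) + coeff_c * (x $ 2)\<^sup>2"
proof -
  have "(S $ l \<bullet> x)\<^sup>2 = (S $ l $ 1)\<^sup>2 * (x $ 1)\<^sup>2 + 2 * (S $ l $ 1 * S $ l $ 2) * (x $ 1 * x $ 2)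
      + (S $ l $ 2)\<^sup>2 * (x $ 2)\<^sup>2" for l
    by (simp add: inner_vec_def sum_2 power2_eq_square algebra_simps)
  hence "quad x = ((\<Sum>l\<in>UNIV. (S $ l $ 1)\<^sup>2) * (x $ 1)\<^sup>2
      + 2 * (\<Sum>l\<in>UNIV. S $ l $ 1 * S $ l $ 2) * (x $ 1 * x $ 2)
      + (\<Sum>l\<in>UNIV. (S $ l $ 2)\<^sup>2) * (x $ 2)\<^sup>2) / (2 * real CARD('n))"
    by (simp add: quad_def sum.distrib sum_distrib_left sum_distrib_right)
  thus ?thesis
    by (simp add: coeff_a_def coeff_b_def coeff_c_def add_divide_distrib)
qed

lemma coeff_a_pos: "0 < coeff_a"
  using quad_pos[of "vector [1, 0]"] quad_form[of "vector [1, 0]"]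
  by (simp add: vec_eq_iff forall_2)

lemma disc_pos: "0 < coeff_a * coeff_c - coeff_b\<^sup>2"
proof -
  \<comment> \<open>On (b, -a) the form takes the value a (a c - b^2), so positivity of the form
    yields that of the discriminant.\<close>
  define v :: "real^2" where "v = vector [coeff_b, - coeff_a]"
  have "v \<noteq> 0" using coeff_a_pos by (auto simp: v_def vec_eq_iff forall_2)
  moreover have "quad v = coeff_a * (coeff_a * coeff_c - coeff_b\<^sup>2)"
    by (simp add: quad_form v_def power2_eq_square algebra_simps)
  ultimately show ?thesis using quad_pos[of v] coeff_a_pos by (simp add: zero_less_mult_iff)
qed

text \<open>The area of the ellipse \<open>quad x \<le> 1\<close>.\<close>

definition area :: real where "area = pi / sqrt (coeff_a * coeff_c - coeff_b\<^sup>2)"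

lemma area_pos: "0 < area"
  using disc_pos by (simp add: area_def)

text \<open>The entries of the Gram matrix S^T S are 2 |\<Phi>| times the coefficients of the form,
  so its determinant carries the square of that factor.\<close>

lemma area_eq: "area = 2 * pi * real CARD('n) / sqrt (det (transpose S ** S))"
proof -
  have "det (transpose S ** S) = (2 * real CARD('n))\<^sup>2 * (coeff_a * coeff_c - coeff_b\<^sup>2)"
    by (simp add: det_2 matrix_matrix_mult_def transpose_def coeff_a_def coeff_b_def coeff_c_def
        field_simps power2_eq_square)
  hence "sqrt (det (transpose S ** S)) = 2 * real CARD('n) * sqrt (coeff_a * coeff_c - coeff_b\<^sup>2)"
    by (simp add: real_sqrt_mult)
  thus ?thesis by (simp add: area_def)
qed

lemma has_integral_inverse_quad_shell:
  assumes "0 < a" "a \<le> b"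
  shows "((\<lambda>x. 1 / quad x) has_integral area * ln (b / a)) {x. a < quad x \<and> quad x \<le> b}"
proof (rule has_integral_inverse_shell[OF continuous_on_quad _ _ assms])
  fix r :: real
  show "bounded {x. quad x \<le> r}"
  proof (cases "0 \<le> r")
    case True
    thus ?thesis using measure_ellipse(1)[OF coeff_a_pos disc_pos] by (simp add: quad_form)
  next
    case False
    have "0 \<le> quad x" for x by (rule order_trans[OF _ quad_ge]) simp
    hence "\<not> quad x \<le> r" for x using False by (meson order_trans)
    thus ?thesis by simp
  qed
  show "measure lebesgue {x. quad x \<le> r} = area * r" if "0 \<le> r"
    using measure_ellipse(2)[OF coeff_a_pos disc_pos that] by (simp add: quad_form area_def)
qed

text \<open>The difference of the reciprocals is (Q - p)/(p Q), with numerator O(M^4) and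
  denominator at least a constant times M^4. The abstract \<open>u\<close> covers both 1 - cos and
  its Taylor polynomials.\<close>

lemma inverse_avg_close:
  fixes u :: "real \<Rightarrow> real" and p :: "real^2 \<Rightarrow> real"
  assumes p: "p x = (1 / real CARD('n)) * (\<Sum>l\<in>UNIV. u (S $ l \<bullet> x))" and x: "x \<noteq> 0"
    and u: "\<And>l. 0 \<le> u (S $ l \<bullet> x)" "\<And>l. u (S $ l \<bullet> x) \<le> (S $ l \<bullet> x)\<^sup>2 / 2"
      "\<And>l. (S $ l \<bullet> x)\<^sup>2 / 2 - (S $ l \<bullet> x) ^ 4 / 24 \<le> u (S $ l \<bullet> x)"
    and low: "(x $ 1)\<^sup>2 / 36 \<le> u (x $ 1)" "(x $ 2)\<^sup>2 / 36 \<le> u (x $ 2)"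
  shows "0 < p x" "\<bar>1 / p x - 1 / quad x\<bar> \<le> 12 * (real CARD('n))\<^sup>2 * (sbar S) ^ 4"
proof -
  define M where "M = infnorm x"
  have M: "0 < M" using x by (simp add: M_def infnorm_pos_lt)
  have "M\<^sup>2 / 36 \<le> (\<Sum>l\<in>UNIV. u (S $ l \<bullet> x))"
    using sum_ge_basis[of "\<lambda>l. u (S $ l \<bullet> x)"] u(1) low infnorm_sq_le[of x]
    by (simp add: inner_basis M_def)
  hence "(1 / real CARD('n)) * (M\<^sup>2 / 36) \<le> p x" unfolding p by (intro mult_left_mono) auto
  hence pl: "M\<^sup>2 / (36 * real CARD('n)) \<le> p x" by simp
  have "0 < M\<^sup>2 / (36 * real CARD('n))" using M by simp
  thus pp: "0 < p x" using pl by linarith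
  have "\<bar>(S $ l \<bullet> x)\<^sup>2 / 2 - u (S $ l \<bullet> x)\<bar> \<le> (sbar S) ^ 4 * M ^ 4 / 6" for l
  proof -
    have "\<bar>(S $ l \<bullet> x)\<^sup>2 / 2 - u (S $ l \<bullet> x)\<bar> \<le> ((S $ l \<bullet> x)\<^sup>2)\<^sup>2 / 24"
      using u(2,3)[of l] by simp
    also have "\<dots> \<le> (2 * (sbar S)\<^sup>2 * M\<^sup>2)\<^sup>2 / 24"
      using sq_inner_le[of l x] by (intro divide_right_mono power_mono) (auto simp: M_def)
    also have "\<dots> = (sbar S) ^ 4 * M ^ 4 / 6" by (simp add: power_mult_distrib)
    finally show ?thesis .
  qed
  hence "\<bar>\<Sum>l\<in>UNIV. (S $ l \<bullet> x)\<^sup>2 / 2 - u (S $ l \<bullet> x)\<bar> \<le> real CARD('n) * ((sbar S) ^ 4 * M ^ 4 / 6)"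
    by (intro order_trans[OF sum_abs] sum_UNIV_le)
  moreover have "quad x - p x = (\<Sum>l\<in>UNIV. (S $ l \<bullet> x)\<^sup>2 / 2 - u (S $ l \<bullet> x)) / real CARD('n)"
    by (simp add: quad_def p sum_subtractf diff_divide_distrib flip: sum_divide_distrib)
  ultimately have "\<bar>(quad x - p x) * real CARD('n)\<bar> \<le> real CARD('n) * ((sbar S) ^ 4 * M ^ 4 / 6)"
    by simp
  hence diff: "\<bar>quad x - p x\<bar> \<le> (sbar S) ^ 4 * M ^ 4 / 6" by (simp add: abs_mult mult_ac)
  have "\<bar>1 / p x - 1 / quad x\<bar> = \<bar>quad x - p x\<bar> / (p x * quad x)"
    by (rule abs_diff_inverse[OF pp quad_pos[OF x]])
  \<comment> \<open>The 1/6 is 2^2/24 from the quartic error; with the denominators 36 and 2 it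
    produces 36 * 2/6 = 12.\<close>
  also have "\<dots> \<le> ((sbar S) ^ 4 * M ^ 4 / 6) / ((M\<^sup>2 / (36 * real CARD('n))) * (M\<^sup>2 / (2 * real CARD('n))))"
    using diff pl quad_ge[of x] pp quad_pos[OF x] M
    by (intro frac_le mult_mono mult_pos_pos) (auto simp: M_def)
  also have "\<dots> = 12 * (real CARD('n))\<^sup>2 * (sbar S) ^ 4"
  proof -
    have M4: "M ^ 4 = M\<^sup>2 * M\<^sup>2" by (simp add: power2_eq_square power4_eq_xxxx mult.assoc)
    have eq: "c * (w * w) / 6 / (w / (36 * d) * (w / (2 * d))) = 12 * d\<^sup>2 * c"
      if "0 < w" "0 < d" for c d w :: real
      using that by (simp add: power2_eq_square)
    show ?thesis unfolding M4 by (rule eq) (use M in auto)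
  qed
  finally show "\<bar>1 / p x - 1 / quad x\<bar> \<le> 12 * (real CARD('n))\<^sup>2 * (sbar S) ^ 4" .
qed

lemma inverse_quad_cell:
  assumes n: "n \<ge> 1" and jk: "(j, k) \<noteq> (0, 0)" and x: "x \<in> cell n j k"
  shows "\<bar>1 / quad x - 1 / quad (tvec n j k)\<bar>
    \<le> 6 * (real CARD('n))\<^sup>2 * (sbar S)\<^sup>2 / pi\<^sup>2 * (real n)\<^sup>2 * (1 / real_of_int (max \<bar>j\<bar> \<bar>k\<bar>) ^ 3)"
proof -
  define t where "t = tvec n j k"
  define m where "m = infnorm t"
  have mesh: "0 < mesh n" using n by (simp add: mesh_def)
  hence m: "0 < m" using infnorm_tvec_ge[OF n jk] by (simp add: m_def t_def)
  have xb: "m / 2 \<le> infnorm x" "infnorm x \<le> 2 * m"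
    using infnorm_cell[OF n jk x] by (simp_all add: m_def t_def)
  have "x \<noteq> 0" using xb m by (auto simp: infnorm_0)
  have "t \<noteq> 0" using m by (auto simp: m_def infnorm_0)
  have qx: "(m / 2)\<^sup>2 / (2 * real CARD('n)) \<le> quad x"
    by (rule order_trans[OF _ quad_ge]) (use xb m in \<open>auto intro!: divide_right_mono power_mono\<close>)
  have qt: "m\<^sup>2 / (2 * real CARD('n)) \<le> quad t" using quad_ge[of t] by (simp add: m_def)
  have "\<bar>1 / quad x - 1 / quad t\<bar> = \<bar>quad t - quad x\<bar> / (quad x * quad t)"
    by (rule abs_diff_inverse[OF quad_pos[OF \<open>x \<noteq> 0\<close>] quad_pos[OF \<open>t \<noteq> 0\<close>]])
  \<comment> \<open>With m the norm of the centre, the numerator is of order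
    \<open>mesh n * m\<close> and the denominator of order m^4. Since m is \<open>mesh n\<close>
    times max(|j|,|k|), the cubic decay and the factor 1/(mesh n)^2 appear.\<close>
  also have "\<dots> \<le> ((sbar S)\<^sup>2 * (mesh n / 2) * (m + 2 * m)) / ((m / 2)\<^sup>2 / (2 * real CARD('n)) * (m\<^sup>2 / (2 * real CARD('n))))"
  proof (intro frac_le mult_mono mult_pos_pos)
    have "\<bar>quad t - quad x\<bar> \<le> (sbar S)\<^sup>2 * infnorm (t - x) * (infnorm t + infnorm x)"
      by (rule quad_diff)
    also have "\<dots> \<le> (sbar S)\<^sup>2 * (mesh n / 2) * (m + 2 * m)"
      using x xb m mesh by (intro mult_mono add_mono mult_nonneg_nonneg)
        (auto simp: mem_cell_iff t_def mesh_def infnorm_sub m_def infnorm_pos_le intro: add_nonneg_nonneg)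
    finally show "\<bar>quad t - quad x\<bar> \<le> (sbar S)\<^sup>2 * (mesh n / 2) * (m + 2 * m)" .
  qed (use qx qt m mesh quad_pos[OF \<open>x \<noteq> 0\<close>] quad_pos[OF \<open>t \<noteq> 0\<close>] in auto)
  also have "\<dots> = 24 * (real CARD('n))\<^sup>2 * (sbar S)\<^sup>2 * mesh n / m ^ 3"
  proof -
    have "c * (h / 2) * (m + 2 * m) / ((m / 2)\<^sup>2 / (2 * d) * (m\<^sup>2 / (2 * d))) = 24 * d\<^sup>2 * c * h / m ^ 3"
      if "0 < d" for c d h :: real
      using that m by (simp add: power2_eq_square power3_eq_cube mult_ac)
    thus ?thesis by this simp
  qed
  also have "m = mesh n * real_of_int (max \<bar>j\<bar> \<bar>k\<bar>)" by (simp add: m_def t_def infnorm_tvec)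
  also have "24 * (real CARD('n))\<^sup>2 * (sbar S)\<^sup>2 * mesh n / (mesh n * y) ^ 3
      = 6 * (real CARD('n))\<^sup>2 * (sbar S)\<^sup>2 / pi\<^sup>2 * (real n)\<^sup>2 * (1 / y ^ 3)" for y
  proof -
    have "24 * c * d * mesh n / (mesh n * y) ^ 3 = c * d * (24 / (mesh n)\<^sup>2) * (1 / y ^ 3)" for c d
      using mesh by (cases "y = 0") (simp_all add: field_simps power2_eq_square power3_eq_cube)
    also have "24 / (mesh n)\<^sup>2 = 6 / pi\<^sup>2 * (real n)\<^sup>2"
      by (simp add: mesh_def power_divide power_mult_distrib)
    also have "c * d * (6 / pi\<^sup>2 * (real n)\<^sup>2) * z = 6 * c * d / pi\<^sup>2 * (real n)\<^sup>2 * z" for c d z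
      by simp
    finally show ?thesis .
  qed
  finally show ?thesis by (simp only: t_def)
qed

subsection \<open>Asymptotics on the grid\<close>

lemma continuous_on_inverse_quad: "0 \<notin> X \<Longrightarrow> continuous_on X (\<lambda>x. 1 / quad x)"
  using quad_pos by (intro continuous_intros continuous_on_quad) (metis less_irrefl)

lemma zero_notin_grid_cells:
  assumes "n \<ge> 1" "\<And>t. P t \<Longrightarrow> \<bar>t\<bar> \<le> \<rho>"
  shows "0 \<notin> grid_cells P n"
proof
  assume "0 \<in> grid_cells P n"
  hence "pi / real n \<le> infnorm (0 :: real^2)" using infnorm_grid_cells(1)[OF assms] by blast
  moreover have "0 < pi / real n" using assms(1) by simp
  ultimately show False by (simp add: infnorm_0)
qed

lemma integral_inverse_quad_le:
  assumes n: "n \<ge> 1" and \<rho>: "0 \<le> \<rho>" and out: "\<And>t. P t \<Longrightarrow> \<bar>t\<bar> \<le> \<rho>"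
  shows "integral (grid_cells P n) (\<lambda>x. 1 / quad x)
    \<le> area * (ln (2 * real CARD('n) * ((sbar S)\<^sup>2 * (\<rho> + pi)\<^sup>2)) + 2 * ln (real n))"
proof -
  \<comment> \<open>The outer level allows for cells sticking out of the square by pi/n <= pi. The
    inner level lies below every value of \<open>quad\<close> on the region, because its points have
    norm at least pi/n > 1/n.\<close>
  define b where "b = (sbar S)\<^sup>2 * (\<rho> + pi)\<^sup>2"
  define a where "a = 1 / (2 * real CARD('n) * (real n)\<^sup>2)"
  have a: "0 < a" using n by (simp add: a_def)
  \<comment> \<open>Comparing both levels with 1 gives a <= b for every n >= 1, not merely for large
    n.\<close>
  have "1 * 1 \<le> b" unfolding b_def
    using sbar_ge_1 pi_ge_two \<rho> by (intro mult_mono one_le_power) auto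
  hence b: "1 \<le> b" by simp
  have "1 * 1 \<le> 2 * real CARD('n) * (real n)\<^sup>2" using n
    by (intro mult_mono) (auto simp: Suc_leI intro: order_trans[of 1 "real CARD('n)"])
  hence "a \<le> 1" by (simp add: a_def)
  hence ab: "a \<le> b" using b by linarith
  note zero = zero_notin_grid_cells[OF n out]
  have sub: "grid_cells P n \<subseteq> {x. a < quad x \<and> quad x \<le> b}"
  proof clarify
    fix x assume x: "x \<in> grid_cells P n"
    have lo: "pi / real n \<le> infnorm x" and hi: "infnorm x \<le> \<rho> + pi / real n"
      using infnorm_grid_cells[of n P \<rho> x] n out x by blast+
    have "1 / real n < pi / real n" using n pi_gt3 by (simp add: divide_strict_right_mono)
    hence "(1 / real n)\<^sup>2 < (infnorm x)\<^sup>2" using lo by (intro power_strict_mono) auto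
    hence "(1 / real n)\<^sup>2 / (2 * real CARD('n)) < (infnorm x)\<^sup>2 / (2 * real CARD('n))"
      by (intro divide_strict_right_mono) auto
    hence "a < quad x" using quad_ge[of x] by (simp add: a_def power_divide mult_ac)
    moreover have "pi / real n \<le> pi / 1" using n by (intro divide_left_mono) auto
    hence "(infnorm x)\<^sup>2 \<le> (\<rho> + pi)\<^sup>2" using hi by (intro power_mono) (auto simp: infnorm_pos_le)
    hence "quad x \<le> b"
      unfolding b_def by (intro order_trans[OF quad_le] mult_left_mono) auto
    ultimately show "a < quad x \<and> quad x \<le> b" ..
  qed
  have "integral (grid_cells P n) (\<lambda>x. 1 / quad x) \<le> integral {x. a < quad x \<and> quad x \<le> b} (\<lambda>x. 1 / quad x)"
  proof (rule integral_subset_le[OF sub])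
    show "(\<lambda>x. 1 / quad x) integrable_on grid_cells P n"
      using has_integral_grid_cells[OF n finite_grid_index[OF n \<rho> out]
          continuous_on_inverse_quad[OF zero]] by blast
    show "(\<lambda>x. 1 / quad x) integrable_on {x. a < quad x \<and> quad x \<le> b}"
      using has_integral_inverse_quad_shell[OF a ab] by blast
  qed (use a in auto)
  also have "\<dots> = area * ln (b / a)"
    by (rule integral_unique[OF has_integral_inverse_quad_shell[OF a ab]])
  also have "b / a = (2 * real CARD('n) * b) * (real n)\<^sup>2" by (simp add: a_def)
  also have "ln \<dots> = ln (2 * real CARD('n) * b) + 2 * ln (real n)"
    using b n by (simp add: ln_mult ln_realpow)
  finally show ?thesis by (simp only: b_def)
qed

lemma integral_inverse_quad_ge:
  assumes n: "n \<ge> 1" and \<rho>: "0 \<le> \<rho>" and out: "\<And>t. P t \<Longrightarrow> \<bar>t\<bar> \<le> \<rho>"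
    and r: "0 < r" and ins: "\<And>t. \<bar>t\<bar> < r \<Longrightarrow> P t"
  defines "b \<equiv> (r / 4)\<^sup>2 / (2 * real CARD('n))"
  assumes n1: "2 * pi / r \<le> real n" and n2: "(2 * pi * sbar S)\<^sup>2 / b \<le> real n"
  shows "area * (ln (b / (2 * pi * sbar S)\<^sup>2) + 2 * ln (real n))
    \<le> integral (grid_cells P n) (\<lambda>x. 1 / quad x)"
proof -
  \<comment> \<open>quad x > a forces norm above 2 pi/n, hence outside the central cell; quad x <= b
    forces norm at most r/4, and with pi/n <= r/2 the cell centre stays within r. The condition
    \<open>n2\<close> yields a <= b via n <= n^2.\<close>
  define a where "a = (2 * pi * sbar S)\<^sup>2 / (real n)\<^sup>2"
  have a: "0 < a" using n sbar_ge_1 by (simp add: a_def)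
  have b: "0 < b" using r by (simp add: b_def)
  have "real n * 1 \<le> real n * real n" using n by (intro mult_left_mono) auto
  hence "(2 * pi * sbar S)\<^sup>2 / b \<le> (real n)\<^sup>2" using n2 by (simp add: power2_eq_square)
  hence ab: "a \<le> b" using b n by (simp add: a_def field_simps)
  note zero = zero_notin_grid_cells[OF n out]
  have sub: "{x. a < quad x \<and> quad x \<le> b} \<subseteq> grid_cells P n"
  proof clarify
    fix x assume x: "a < quad x" "quad x \<le> b"
    have "(sbar S)\<^sup>2 * (2 * pi / real n)\<^sup>2 < (sbar S)\<^sup>2 * (infnorm x)\<^sup>2"
      using x(1) quad_le[of x] by (simp add: a_def power_divide power_mult_distrib mult_ac)
    hence "(2 * pi / real n)\<^sup>2 < (infnorm x)\<^sup>2"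
      by (simp add: mult_less_cancel_left)
    hence "2 * pi / real n < infnorm x" by (rule power_less_imp_less_base) (rule infnorm_pos_le)
    moreover have "0 < pi / real n" using n by simp
    ultimately have 1: "pi / real n < infnorm x" by simp
    have "(infnorm x)\<^sup>2 / (2 * real CARD('n)) \<le> (r / 4)\<^sup>2 / (2 * real CARD('n))"
      using quad_ge[of x] x(2) unfolding b_def by linarith
    hence "(infnorm x)\<^sup>2 \<le> (r / 4)\<^sup>2" by (simp add: divide_le_cancel)
    hence "infnorm x \<le> r / 4" by (rule power2_le_imp_le) (use r in auto)
    moreover have "pi / real n \<le> r / 2" using n1 n r by (simp add: field_simps)
    ultimately have "infnorm x + pi / real n < r" using r by linarith
    thus "x \<in> grid_cells P n" using grid_cells_memI[of n r P x] n ins 1 by blast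
  qed
  have "area * ln (b / a) = integral {x. a < quad x \<and> quad x \<le> b} (\<lambda>x. 1 / quad x)"
    by (rule integral_unique[OF has_integral_inverse_quad_shell[OF a ab], symmetric])
  also have "\<dots> \<le> integral (grid_cells P n) (\<lambda>x. 1 / quad x)"
  proof (rule integral_subset_le[OF sub])
    show "(\<lambda>x. 1 / quad x) integrable_on grid_cells P n"
      using has_integral_grid_cells[OF n finite_grid_index[OF n \<rho> out]
          continuous_on_inverse_quad[OF zero]] by blast
    show "(\<lambda>x. 1 / quad x) integrable_on {x. a < quad x \<and> quad x \<le> b}"
      using has_integral_inverse_quad_shell[OF a ab] by blast
    have "0 < quad x" if "x \<in> grid_cells P n" for x using that zero by (intro quad_pos) auto
    thus "\<forall>x\<in>grid_cells P n. 0 \<le> 1 / quad x" by (auto intro: less_imp_le)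
  qed
  also have "b / a = b / (2 * pi * sbar S)\<^sup>2 * (real n)\<^sup>2" by (simp add: a_def)
  also have "ln \<dots> = ln (b / (2 * pi * sbar S)\<^sup>2) + 2 * ln (real n)"
    using b n sbar_ge_1 by (subst ln_mult_pos) (auto simp: ln_realpow)
  finally show ?thesis .
qed

definition main_term :: "nat \<Rightarrow> real" where
  "main_term n = real CARD('n) / (pi * sqrt (det (transpose S ** S))) * (real n)\<^sup>2 * ln (real n)"

lemma main_term_eq: "main_term n = 1 / (mesh n)\<^sup>2 * (2 * area * ln (real n))"
proof -
  have "1 / (mesh n)\<^sup>2 = (real n)\<^sup>2 / (4 * pi\<^sup>2)"
    by (simp add: mesh_def power_divide power_mult_distrib)
  thus ?thesis by (simp add: main_term_def area_eq power2_eq_square)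
qed

lemma grid_integral_inverse_quad:
  assumes \<rho>: "0 \<le> \<rho>" and out: "\<And>t. P t \<Longrightarrow> \<bar>t\<bar> \<le> \<rho>"
    and r: "0 < r" and ins: "\<And>t. \<bar>t\<bar> < r \<Longrightarrow> P t"
  shows "(\<lambda>n. grid_integral n (grid_cells P n) (\<lambda>x. 1 / quad x) - main_term n) \<in> O(\<lambda>n. (real n)\<^sup>2)"
proof -
  define b where "b = (r / 4)\<^sup>2 / (2 * real CARD('n))"
  define c1 where "c1 = ln (2 * real CARD('n) * ((sbar S)\<^sup>2 * (\<rho> + pi)\<^sup>2))"
  define c2 where "c2 = ln (b / (2 * pi * sbar S)\<^sup>2)"
  define C where "C = area * (\<bar>c1\<bar> + \<bar>c2\<bar>)"
  have "eventually (\<lambda>n. n \<ge> (1::nat)) at_top" by (rule eventually_ge_at_top)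
  moreover have "eventually (\<lambda>n. 2 * pi / r \<le> real n) at_top" by real_asymp
  moreover have "eventually (\<lambda>n. (2 * pi * sbar S)\<^sup>2 / b \<le> real n) at_top" by real_asymp
  ultimately have "eventually (\<lambda>n. norm (grid_integral n (grid_cells P n) (\<lambda>x. 1 / quad x) - main_term n)
      \<le> C / (4 * pi\<^sup>2) * norm ((real n)\<^sup>2)) at_top"
  proof eventually_elim
    case (elim n)
    define J where "J = integral (grid_cells P n) (\<lambda>x. 1 / quad x)"
    have up: "J \<le> area * (c1 + 2 * ln (real n))"
      unfolding J_def c1_def by (rule integral_inverse_quad_le[OF elim(1) \<rho> out])
    have lo: "area * (c2 + 2 * ln (real n)) \<le> J"
      unfolding J_def c2_def b_def
      by (rule integral_inverse_quad_ge[OF elim(1) \<rho> out r ins elim(2) elim(3)[unfolded b_def]])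
    have "area * c1 \<le> C"
      unfolding C_def using area_pos by (intro mult_left_mono) auto
    moreover have "area * (- (\<bar>c1\<bar> + \<bar>c2\<bar>)) \<le> area * c2"
      using area_pos by (intro mult_left_mono) auto
    hence "- C \<le> area * c2" by (simp only: C_def mult_minus_right)
    ultimately have J: "\<bar>J - 2 * area * ln (real n)\<bar> \<le> C"
      using up lo by (simp add: abs_le_iff algebra_simps)
    have "grid_integral n (grid_cells P n) (\<lambda>x. 1 / quad x) - main_term n
        = 1 / (mesh n)\<^sup>2 * (J - 2 * area * ln (real n))"
      by (simp only: grid_integral_def main_term_eq J_def right_diff_distrib)
    also have "1 / (mesh n)\<^sup>2 = (real n)\<^sup>2 / (4 * pi\<^sup>2)"
      by (simp add: mesh_def power_divide power_mult_distrib)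
    finally have "norm (grid_integral n (grid_cells P n) (\<lambda>x. 1 / quad x) - main_term n)
        = (real n)\<^sup>2 / (4 * pi\<^sup>2) * \<bar>J - 2 * area * ln (real n)\<bar>"
      by (simp add: abs_mult)
    also have "\<dots> \<le> (real n)\<^sup>2 / (4 * pi\<^sup>2) * C"
      using J by (intro mult_left_mono) auto
    finally show ?case by (simp add: mult_ac)
  qed
  thus ?thesis by (rule bigoI)
qed

text \<open>The sum of 1/Q over the cell centres is the pivot \<open>G\<close>. The integral of 1/Q
  determines it up to O(n^2), and the integral and sum of g are then compared with it.\<close>

lemma grid_asymptotics:
  assumes \<rho>: "0 \<le> \<rho>" and out: "\<And>t. P t \<Longrightarrow> \<bar>t\<bar> \<le> \<rho>"
    and r: "0 < r" and ins: "\<And>t. \<bar>t\<bar> < r \<Longrightarrow> P t"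
    and C: "0 \<le> C"
    and g: "eventually (\<lambda>n. continuous_on (grid_cells P n) g \<and>
        (\<forall>x\<in>grid_cells P n. \<bar>g x - 1 / quad x\<bar> \<le> C)) at_top"
  shows "(\<lambda>n. grid_sum n (grid_cells P n) g - main_term n) \<in> O(\<lambda>n. (real n)\<^sup>2)"
    and "(\<lambda>n. grid_integral n (grid_cells P n) g - main_term n) \<in> O(\<lambda>n. (real n)\<^sup>2)"
proof -
  define L where "L = 6 * (real CARD('n))\<^sup>2 * (sbar S)\<^sup>2 / pi\<^sup>2"
  have L: "0 \<le> L" by (simp add: L_def)
  define G where "G = (\<lambda>n. \<Sum>p\<in>grid_index P n. 1 / quad (tvec n (fst p) (snd p)))"
  have card: "C * real (card (grid_index P n)) \<le> C * (\<rho> + 1)\<^sup>2 * (real n)\<^sup>2" if "n \<ge> 1" "0 \<le> C" for n C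
    using mult_left_mono[OF card_grid_index[OF that(1) \<rho> out] that(2)] by (simp add: mult_ac)
  \<comment> \<open>Used twice: with h = 1/Q and C = 0 to find the size of \<open>G\<close>, and
    with h = g.\<close>
  have integral_G: "\<bar>grid_integral n (grid_cells P n) h - G n\<bar> \<le> (C * (\<rho> + 1)\<^sup>2 + 16 * L) * (real n)\<^sup>2"
    if n: "n \<ge> 1" and C: "0 \<le> C" and cont: "continuous_on (grid_cells P n) h"
      and h: "\<forall>x\<in>grid_cells P n. \<bar>h x - 1 / quad x\<bar> \<le> C" for n h C
  proof -
    define B where "B = (\<lambda>p :: int \<times> int. C + L * (real n)\<^sup>2 * (1 / real_of_int (max \<bar>fst p\<bar> \<bar>snd p\<bar>) ^ 3))"
    have "\<bar>grid_integral n (grid_cells P n) h - (\<Sum>p\<in>grid_index P n. (\<lambda>p. 1 / quad (tvec n (fst p) (snd p))) p)\<bar>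
        \<le> (\<Sum>p\<in>grid_index P n. B p)"
    proof (rule grid_integral_minus_sum[OF n finite_grid_index[OF n \<rho> out] cont])
      fix j k x assume jk: "(j, k) \<in> grid_index P n" and x: "x \<in> cell n j k"
      have "x \<in> grid_cells P n" using jk x by (force simp: grid_cells_def)
      hence 1: "\<bar>h x - 1 / quad x\<bar> \<le> C" using h by blast
      have "(j, k) \<noteq> (0, 0)" using jk by (auto simp: grid_index_def)
      from inverse_quad_cell[OF n this x]
      have "\<bar>1 / quad x - 1 / quad (tvec n j k)\<bar>
          \<le> L * (real n)\<^sup>2 * (1 / real_of_int (max \<bar>j\<bar> \<bar>k\<bar>) ^ 3)" by (simp only: L_def)
      hence "\<bar>h x - 1 / quad (tvec n j k)\<bar> \<le> C + L * (real n)\<^sup>2 * (1 / real_of_int (max \<bar>j\<bar> \<bar>k\<bar>) ^ 3)"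
        using 1 by linarith
      thus "\<bar>h x - 1 / quad (tvec n (fst (j, k)) (snd (j, k)))\<bar> \<le> B (j, k)" by (simp only: B_def fst_conv snd_conv)
    qed
    also have "(\<Sum>p\<in>grid_index P n. B p) = C * real (card (grid_index P n))
        + L * (real n)\<^sup>2 * (\<Sum>p\<in>grid_index P n. 1 / real_of_int (max \<bar>fst p\<bar> \<bar>snd p\<bar>) ^ 3)"
      by (simp only: B_def sum.distrib sum_distrib_left sum_constant mult.commute)
    also have "\<dots> \<le> C * (\<rho> + 1)\<^sup>2 * (real n)\<^sup>2 + L * (real n)\<^sup>2 * 16"
      using L by (intro add_mono card[OF n C] mult_left_mono grid_index_sum_bound[OF n \<rho> out]) auto
    finally show ?thesis by (simp add: G_def algebra_simps)
  qed
  have IG: "(\<lambda>n. grid_integral n (grid_cells P n) (\<lambda>x. 1 / quad x) - G n) \<in> O(\<lambda>n. (real n)\<^sup>2)"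
  proof (rule bigoI[OF eventually_mono[OF eventually_ge_at_top[of 1]]])
    fix n :: nat assume n: "n \<ge> 1"
    show "norm (grid_integral n (grid_cells P n) (\<lambda>x. 1 / quad x) - G n) \<le> (16 * L) * norm ((real n)\<^sup>2)"
      using integral_G[OF n, of 0 "\<lambda>x. 1 / quad x"]
        continuous_on_inverse_quad[OF zero_notin_grid_cells[OF n out]] by simp
  qed
  have "(\<lambda>n. grid_integral n (grid_cells P n) (\<lambda>x. 1 / quad x) - main_term n) \<in> O(\<lambda>n. (real n)\<^sup>2)"
    by (rule grid_integral_inverse_quad[OF \<rho> out r ins])
  from sum_in_bigo(2)[OF this IG]
  have G: "(\<lambda>n. G n - main_term n) \<in> O(\<lambda>n. (real n)\<^sup>2)" by simp
  have "(\<lambda>n. grid_integral n (grid_cells P n) g - G n) \<in> O(\<lambda>n. (real n)\<^sup>2)"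
  proof (rule bigoI[OF eventually_mono[OF eventually_conj[OF eventually_ge_at_top[of 1] g]]])
    fix n :: nat assume n: "n \<ge> 1 \<and> continuous_on (grid_cells P n) g \<and>
        (\<forall>x\<in>grid_cells P n. \<bar>g x - 1 / quad x\<bar> \<le> C)"
    show "norm (grid_integral n (grid_cells P n) g - G n)
        \<le> (C * (\<rho> + 1)\<^sup>2 + 16 * L) * norm ((real n)\<^sup>2)"
      using integral_G[of n C g] n C by simp
  qed
  from sum_in_bigo(1)[OF this G]
  show "(\<lambda>n. grid_integral n (grid_cells P n) g - main_term n) \<in> O(\<lambda>n. (real n)\<^sup>2)" by simp
  have "(\<lambda>n. grid_sum n (grid_cells P n) g - G n) \<in> O(\<lambda>n. (real n)\<^sup>2)"
  proof (rule bigoI[OF eventually_mono[OF eventually_conj[OF eventually_ge_at_top[of 1] g]]])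
    fix n :: nat assume n: "n \<ge> 1 \<and> continuous_on (grid_cells P n) g \<and>
        (\<forall>x\<in>grid_cells P n. \<bar>g x - 1 / quad x\<bar> \<le> C)"
    have "\<bar>grid_sum n (grid_cells P n) g - G n\<bar>
        = \<bar>\<Sum>p\<in>grid_index P n. g (tvec n (fst p) (snd p)) - 1 / quad (tvec n (fst p) (snd p))\<bar>"
      using n by (simp add: grid_sum_grid_cells G_def sum_subtractf)
    also have "\<dots> \<le> (\<Sum>p\<in>grid_index P n. C)"
    proof (rule order_trans[OF sum_abs sum_mono])
      fix p assume "p \<in> grid_index P n"
      hence "tvec n (fst p) (snd p) \<in> grid_cells P n" using n by (simp add: tvec_mem_grid_cells_iff)
      thus "\<bar>g (tvec n (fst p) (snd p)) - 1 / quad (tvec n (fst p) (snd p))\<bar> \<le> C" using n by blast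
    qed
    also have "\<dots> \<le> C * (\<rho> + 1)\<^sup>2 * (real n)\<^sup>2" using card[of n C] n C by (simp add: mult.commute)
    finally show "norm (grid_sum n (grid_cells P n) g - G n) \<le> C * (\<rho> + 1)\<^sup>2 * norm ((real n)\<^sup>2)" by simp
  qed
  from sum_in_bigo(1)[OF this G]
  show "(\<lambda>n. grid_sum n (grid_cells P n) g - main_term n) \<in> O(\<lambda>n. (real n)\<^sup>2)" by simp
qed

section \<open>Comparing \<open>f_inv\<close> and \<open>f_inv_taylor\<close> with
  \<open>1 / quad\<close> on the two regions\<close>

lemma psi_eq: "psi S x = (1 / real CARD('n)) * (\<Sum>l\<in>UNIV. 1 - cos (S $ l \<bullet> x))"
  by (simp add: psi_def sum_subtractf right_diff_distrib)

lemma f_inv_close: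
  assumes "x \<noteq> 0" "infnorm x \<le> 3 * pi / 2"
  shows "0 < psi S x" "\<bar>f_inv S x - 1 / quad x\<bar> \<le> 12 * (real CARD('n))\<^sup>2 * (sbar S) ^ 4"
proof -
  have "\<bar>x $ i\<bar> \<le> 3 * pi / 2" for i
    using component_le_infnorm_cart[of x i] assms(2) by linarith
  hence low: "(x $ i)\<^sup>2 / 36 \<le> 1 - cos (x $ i)" for i by (rule one_minus_cos_ge)
  note close = inverse_avg_close[of "psi S" x "\<lambda>y. 1 - cos y", OF psi_eq assms(1) _
      one_minus_cos_bounds low low]
  show "0 < psi S x" "\<bar>f_inv S x - 1 / quad x\<bar> \<le> 12 * (real CARD('n))\<^sup>2 * (sbar S) ^ 4"
    unfolding f_inv_def by (rule close; simp)+
qed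

text \<open>Unlike for the cosine, nonnegativity of each summand is not automatic here, so the range
  condition y^2 <= 11 is imposed on every row.\<close>

lemma f_inv_taylor_close:
  assumes "x \<noteq> 0" "m \<ge> 1" "2 * (sbar S)\<^sup>2 * (infnorm x)\<^sup>2 \<le> 11"
  shows "0 < taylor_psi S m x"
    "\<bar>f_inv_taylor S m x - 1 / quad x\<bar> \<le> 12 * (real CARD('n))\<^sup>2 * (sbar S) ^ 4"
proof -
  have y: "(S $ l \<bullet> x)\<^sup>2 \<le> 11" for l using sq_inner_le[of l x] assms(3) by linarith
  have up: "taylor_term_sum m (S $ l \<bullet> x) \<le> (S $ l \<bullet> x)\<^sup>2 / 2"
    and lo: "(S $ l \<bullet> x)\<^sup>2 / 2 - (S $ l \<bullet> x) ^ 4 / 24 \<le> taylor_term_sum m (S $ l \<bullet> x)" for l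
    using taylor_term_sum_bounds[of "S $ l \<bullet> x" m] y[of l] assms(2) by simp_all
  have low: "(S $ l \<bullet> x)\<^sup>2 / 36 \<le> taylor_term_sum m (S $ l \<bullet> x)" for l
    using quartic_lower_bound[OF y] lo by (rule order_trans)
  hence nonneg: "0 \<le> taylor_term_sum m (S $ l \<bullet> x)" for l
    by (rule order_trans[rotated]) simp
  note close = inverse_avg_close[of "taylor_psi S m" x "taylor_term_sum m",
      OF taylor_psi_eq assms(1) nonneg up lo low[of i1, unfolded inner_basis] low[of i2, unfolded inner_basis]]
  show "0 < taylor_psi S m x"
    "\<bar>f_inv_taylor S m x - 1 / quad x\<bar> \<le> 12 * (real CARD('n))\<^sup>2 * (sbar S) ^ 4"
    unfolding f_inv_taylor_def by (rule close)+
qed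

lemma eventually_f_inv:
  assumes \<rho>: "\<rho> \<le> pi" and out: "\<And>t. P t \<Longrightarrow> \<bar>t\<bar> \<le> \<rho>"
  shows "eventually (\<lambda>n. continuous_on (grid_cells P n) (f_inv S) \<and>
    (\<forall>x\<in>grid_cells P n. \<bar>f_inv S x - 1 / quad x\<bar> \<le> 12 * (real CARD('n))\<^sup>2 * (sbar S) ^ 4)) at_top"
  \<comment> \<open>From n = 2 on, cells overshoot by at most pi/2, which keeps all points within 3
    pi/2.\<close>
  using eventually_ge_at_top[of 2]
proof eventually_elim
  case (elim n)
  hence n: "n \<ge> 1" by simp
  have x: "x \<noteq> 0 \<and> infnorm x \<le> 3 * pi / 2" if "x \<in> grid_cells P n" for x
  proof -
    have "pi / real n \<le> pi / 2" using elim by (intro divide_left_mono) auto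
    moreover have "infnorm x \<le> \<rho> + pi / real n"
      using infnorm_grid_cells(2)[of n P \<rho> x] n out that by blast
    moreover have "0 \<notin> grid_cells P n" by (rule zero_notin_grid_cells[OF n out])
    ultimately have "x \<noteq> 0" "infnorm x \<le> pi + pi / 2" using \<rho> that by (metis, linarith)
    thus ?thesis by simp
  qed
  have "continuous_on (grid_cells P n) (\<lambda>x. 1 / psi S x)"
  proof (intro continuous_intros ballI)
    show "continuous_on (grid_cells P n) (psi S)" unfolding psi_def by (intro continuous_intros)
    show "psi S x \<noteq> 0" if "x \<in> grid_cells P n" for x
      using f_inv_close(1)[of x] x[OF that] by simp
  qed
  thus ?case using f_inv_close(2) x by (simp add: f_inv_def[abs_def])
qed

text \<open>For small n the outermost cells may reach beyond the range of the Taylor bounds,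
  possibly to zeros of the truncated polynomial, hence a bound for large n.\<close>

lemma eventually_f_inv_taylor:
  assumes \<beta>: "0 < \<beta>" "\<beta> < 1" and m: "m \<ge> 1"
  defines "P \<equiv> \<lambda>t. \<bar>t\<bar> \<le> sqrt (5 * (1 - \<beta>)) / sbar S"
  shows "eventually (\<lambda>n. continuous_on (grid_cells P n) (f_inv_taylor S m) \<and>
    (\<forall>x\<in>grid_cells P n. \<bar>f_inv_taylor S m x - 1 / quad x\<bar> \<le> 12 * (real CARD('n))\<^sup>2 * (sbar S) ^ 4)) at_top"
proof -
  define \<rho> where "\<rho> = sqrt (5 * (1 - \<beta>)) / sbar S"
  have out: "\<And>t. P t \<Longrightarrow> \<bar>t\<bar> \<le> \<rho>" by (simp add: P_def \<rho>_def)
  have "((\<lambda>n. 2 * (sbar S)\<^sup>2 * (\<rho> + pi / real n)\<^sup>2) \<longlongrightarrow> 2 * (sbar S)\<^sup>2 * (\<rho> + 0)\<^sup>2) at_top"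
    by (intro tendsto_intros lim_const_over_n)
  \<comment> \<open>The limit is 10 (1 - \<beta>); this is why the truncation radius carries the factor 5.\<close>
  moreover have "2 * (sbar S)\<^sup>2 * (\<rho> + 0)\<^sup>2 < 11"
    using sbar_ge_1 \<beta> by (simp add: \<rho>_def power_divide)
  ultimately have "eventually (\<lambda>n. 2 * (sbar S)\<^sup>2 * (\<rho> + pi / real n)\<^sup>2 < 11) at_top"
    by (rule order_tendstoD)
  with eventually_ge_at_top[of 1] show ?thesis
  proof eventually_elim
    case (elim n)
    have x: "x \<noteq> 0 \<and> 2 * (sbar S)\<^sup>2 * (infnorm x)\<^sup>2 \<le> 11" if "x \<in> grid_cells P n" for x
    proof -
      have "infnorm x \<le> \<rho> + pi / real n"
        using infnorm_grid_cells(2)[of n P \<rho> x] elim(1) out that by blast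
      hence "2 * (sbar S)\<^sup>2 * (infnorm x)\<^sup>2 \<le> 2 * (sbar S)\<^sup>2 * (\<rho> + pi / real n)\<^sup>2"
        by (intro mult_left_mono power_mono) (auto simp: infnorm_pos_le)
      moreover have "0 \<notin> grid_cells P n" by (rule zero_notin_grid_cells[OF elim(1) out])
      ultimately show ?thesis using elim(2) that by auto
    qed
    have "continuous_on (grid_cells P n) (\<lambda>x. 1 / taylor_psi S m x)"
    proof (intro continuous_intros ballI)
      show "continuous_on (grid_cells P n) (taylor_psi S m)"
        unfolding taylor_psi_def by (intro continuous_intros) auto
      show "taylor_psi S m x \<noteq> 0" if "x \<in> grid_cells P n" for x
        using f_inv_taylor_close(1)[of x m] x[OF that] m by simp
    qed
    thus ?case using f_inv_taylor_close(2) x m by (simp add: f_inv_taylor_def[abs_def])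
  qed
qed

lemma Dom_asymptotics:
  shows "(\<lambda>n. F n (f_inv S) - main_term n) \<in> O(\<lambda>n. (real n)\<^sup>2)"
    and "(\<lambda>n. I n (f_inv S) - main_term n) \<in> O(\<lambda>n. (real n)\<^sup>2)"
    and "(\<lambda>n. F n (f_inv_taylor S 1) - main_term n) \<in> O(\<lambda>n. (real n)\<^sup>2)"
    and "(\<lambda>n. I n (f_inv_taylor S 1) - main_term n) \<in> O(\<lambda>n. (real n)\<^sup>2)"
proof -
  define P where "P = (\<lambda>t::real. t \<in> {-pi..<pi})"
  \<comment> \<open>The half-open interval lies between the open and the closed one, so pi serves as
    both inner and outer radius.\<close>
  have out: "\<bar>t\<bar> \<le> pi" if "P t" for t using that by (auto simp: P_def)
  have ins: "P t" if "\<bar>t\<bar> < pi" for t using that by (auto simp: P_def)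
  have D: "Dom n = grid_cells P n" if "n \<ge> 1" for n
    using Dom_eq_grid_cells[OF that] by (simp add: P_def)
  have nonneg: "0 \<le> 12 * (real CARD('n))\<^sup>2 * (sbar S) ^ 4" by simp
  have asym: "(\<lambda>n. grid_sum n (grid_cells P n) g - main_term n) \<in> O(\<lambda>n. (real n)\<^sup>2)"
      "(\<lambda>n. grid_integral n (grid_cells P n) g - main_term n) \<in> O(\<lambda>n. (real n)\<^sup>2)"
    if "0 \<le> C" "eventually (\<lambda>n. continuous_on (grid_cells P n) g \<and>
        (\<forall>x\<in>grid_cells P n. \<bar>g x - 1 / quad x\<bar> \<le> C)) at_top" for g C
    by (rule grid_asymptotics[of pi P pi C g, OF pi_ge_zero _ pi_gt_zero _ that], erule out, erule ins)+
  have ev: "eventually (\<lambda>n. continuous_on (grid_cells P n) (f_inv S) \<and>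
    (\<forall>x\<in>grid_cells P n. \<bar>f_inv S x - 1 / quad x\<bar> \<le> 12 * (real CARD('n))\<^sup>2 * (sbar S) ^ 4)) at_top"
    by (rule eventually_f_inv[OF order_refl out])
  show "(\<lambda>n. F n (f_inv S) - main_term n) \<in> O(\<lambda>n. (real n)\<^sup>2)"
    by (rule bigo_cong_ge_1[OF asym(1)[OF nonneg ev]]) (auto simp: F_def D)
  show "(\<lambda>n. I n (f_inv S) - main_term n) \<in> O(\<lambda>n. (real n)\<^sup>2)"
    by (rule bigo_cong_ge_1[OF asym(2)[OF nonneg ev]]) (auto simp: I_def D)
  have quad: "f_inv_taylor S 1 = (\<lambda>x. 1 / quad x)"
    by (rule ext) (simp only: f_inv_taylor_def taylor_psi_1)
  \<comment> \<open>On the full square the Taylor bounds may fail, but f_1 is exactly 1/Q, so the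
    error constant is 0.\<close>
  have ev1: "eventually (\<lambda>n. continuous_on (grid_cells P n) (f_inv_taylor S 1) \<and>
        (\<forall>x\<in>grid_cells P n. \<bar>f_inv_taylor S 1 x - 1 / quad x\<bar> \<le> 0)) at_top"
    unfolding quad
    by (rule eventually_mono[OF eventually_ge_at_top[of 1]])
      (use zero_notin_grid_cells[where P = P, OF _ out] in \<open>auto intro: continuous_on_inverse_quad\<close>)
  show "(\<lambda>n. F n (f_inv_taylor S 1) - main_term n) \<in> O(\<lambda>n. (real n)\<^sup>2)"
    by (rule bigo_cong_ge_1[OF asym(1)[OF order_refl ev1]]) (simp_all add: F_def D)
  show "(\<lambda>n. I n (f_inv_taylor S 1) - main_term n) \<in> O(\<lambda>n. (real n)\<^sup>2)"
    by (rule bigo_cong_ge_1[OF asym(2)[OF order_refl ev1]]) (simp_all add: I_def D)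
qed

lemma Dom_beta_asymptotics:
  assumes \<beta>: "0 < \<beta>" "\<beta> < 1" and m: "m \<ge> 1"
  shows "(\<lambda>n. F_beta S \<beta> n (f_inv S) - main_term n) \<in> O(\<lambda>n. (real n)\<^sup>2)"
    and "(\<lambda>n. I_beta S \<beta> n (f_inv S) - main_term n) \<in> O(\<lambda>n. (real n)\<^sup>2)"
    and "(\<lambda>n. F_beta S \<beta> n (f_inv_taylor S m) - main_term n) \<in> O(\<lambda>n. (real n)\<^sup>2)"
    and "(\<lambda>n. I_beta S \<beta> n (f_inv_taylor S m) - main_term n) \<in> O(\<lambda>n. (real n)\<^sup>2)"
proof -
  define \<rho> where "\<rho> = sqrt (5 * (1 - \<beta>)) / sbar S"
  define P where "P = (\<lambda>t. \<bar>t\<bar> \<le> \<rho>)"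
  have out: "\<bar>t\<bar> \<le> \<rho>" if "P t" for t using that by (auto simp: P_def)
  have ins: "P t" if "\<bar>t\<bar> < \<rho>" for t using that by (auto simp: P_def)
  have \<rho>: "0 < \<rho>" using \<beta> sbar_ge_1 by (simp add: \<rho>_def)
  \<comment> \<open>Together with \<open>sbar S\<close> >= 1 this puts the truncated square inside
    [-pi, pi]^2, where the cosine estimates apply.\<close>
  have "sqrt (5 * (1 - \<beta>)) \<le> sqrt (3\<^sup>2)" using \<beta> by (intro real_sqrt_le_mono) simp
  hence "sqrt (5 * (1 - \<beta>)) \<le> 3" by simp
  hence "\<rho> \<le> 3 / 1" unfolding \<rho>_def using sbar_ge_1 \<beta> by (intro frac_le) auto
  hence \<rho>_pi: "\<rho> \<le> pi" using pi_gt3 by simp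
  have D: "Dom_beta S \<beta> n = grid_cells P n" if "n \<ge> 1" for n
    using Dom_beta_eq_grid_cells[OF that] by (simp add: P_def \<rho>_def)
  have nonneg: "0 \<le> 12 * (real CARD('n))\<^sup>2 * (sbar S) ^ 4" by simp
  have asym: "(\<lambda>n. grid_sum n (grid_cells P n) g - main_term n) \<in> O(\<lambda>n. (real n)\<^sup>2)"
      "(\<lambda>n. grid_integral n (grid_cells P n) g - main_term n) \<in> O(\<lambda>n. (real n)\<^sup>2)"
    if "0 \<le> C" "eventually (\<lambda>n. continuous_on (grid_cells P n) g \<and>
        (\<forall>x\<in>grid_cells P n. \<bar>g x - 1 / quad x\<bar> \<le> C)) at_top" for g C
    by (rule grid_asymptotics[of \<rho> P \<rho> C g, OF less_imp_le[OF \<rho>] _ \<rho> _ that], erule out, erule ins)+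
  have ev: "eventually (\<lambda>n. continuous_on (grid_cells P n) (f_inv S) \<and>
    (\<forall>x\<in>grid_cells P n. \<bar>f_inv S x - 1 / quad x\<bar> \<le> 12 * (real CARD('n))\<^sup>2 * (sbar S) ^ 4)) at_top"
    by (rule eventually_f_inv[OF \<rho>_pi out])
  show "(\<lambda>n. F_beta S \<beta> n (f_inv S) - main_term n) \<in> O(\<lambda>n. (real n)\<^sup>2)"
    by (rule bigo_cong_ge_1[OF asym(1)[OF nonneg ev]]) (auto simp: F_beta_def D)
  show "(\<lambda>n. I_beta S \<beta> n (f_inv S) - main_term n) \<in> O(\<lambda>n. (real n)\<^sup>2)"
    by (rule bigo_cong_ge_1[OF asym(2)[OF nonneg ev]]) (auto simp: I_beta_def D)
  note ev_m = eventually_f_inv_taylor[OF \<beta> m, folded \<rho>_def, folded P_def]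
  show "(\<lambda>n. F_beta S \<beta> n (f_inv_taylor S m) - main_term n) \<in> O(\<lambda>n. (real n)\<^sup>2)"
    by (rule bigo_cong_ge_1[OF asym(1)[OF nonneg ev_m]]) (auto simp: F_beta_def D)
  show "(\<lambda>n. I_beta S \<beta> n (f_inv_taylor S m) - main_term n) \<in> O(\<lambda>n. (real n)\<^sup>2)"
    by (rule bigo_cong_ge_1[OF asym(2)[OF nonneg ev_m]]) (auto simp: I_beta_def D)
qed

end

section \<open>From the lattice hypotheses to the two unit rows\<close>

lemma int_span_subset_span: "int_span X \<subseteq> span (X :: 'v::real_vector set)"
proof -
  interpret int_module: module "int_scale :: int \<Rightarrow> 'v \<Rightarrow> 'v"
    by unfold_locales (simp_all add: scaleR_add_right scaleR_add_left)
  show ?thesis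
    unfolding int_span_def
    by (rule int_module.span_minimal)
      (auto simp: int_module.subspace_def intro: span_base span_zero span_add span_scale)
qed

text \<open>Integer independence does not yield real independence (1 and sqrt 2 on a line); full
  rank does. The real span of u and v contains a spanning set, and a single vector cannot span a
  space of dimension 2.\<close>

lemma full_rank_generators:
  fixes u v :: "'v::real_vector"
  assumes dim: "dim (UNIV :: 'v set) = 2" and full: "full_rank_lattice (int_span {u, v})"
  shows "u \<notin> span {v}" "v \<notin> span {u}"
proof -
  obtain B where B: "span B = (UNIV :: 'v set)" "int_span {u, v} = int_span B"
    using full by (auto simp: full_rank_lattice_def)
  interpret int_module: module "int_scale :: int \<Rightarrow> 'v \<Rightarrow> 'v"
    by unfold_locales (simp_all add: scaleR_add_right scaleR_add_left)
  have "B \<subseteq> int_span B" unfolding int_span_def by (rule int_module.span_superset)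
  hence "B \<subseteq> span {u, v}" using int_span_subset_span[of "{u, v}"] B(2) by blast
  hence UNIV: "span {u, v} = UNIV" using B(1) span_minimal[OF _ subspace_span] by blast
  have not_single: "span {w} \<noteq> UNIV" for w :: 'v
    using dim dim_le_card[of UNIV "{w}"] by force
  show "u \<notin> span {v}" using UNIV not_single[of v] span_redundant[of u "{v}"] by auto
  show "v \<notin> span {u}"
    using UNIV not_single[of u] span_redundant[of v "{u}"] by (auto simp: insert_commute)
qed

lemma linear_relation_trivial:
  fixes u v :: "'v::real_vector"
  assumes "u \<notin> span {v}" "x *\<^sub>R u + y *\<^sub>R v = 0"
  shows "x = 0"
proof (rule ccontr)
  assume "x \<noteq> 0"
  have "x *\<^sub>R u = (- y) *\<^sub>R v" using assms(2) by (simp add: eq_neg_iff_add_eq_0)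
  hence "x *\<^sub>R u \<in> span {v}" by (simp add: span_base span_scale span_neg)
  hence "(1 / x) *\<^sub>R (x *\<^sub>R u) \<in> span {v}" by (rule span_scale)
  thus False using assms(1) \<open>x \<noteq> 0\<close> by simp
qed

theorem theorem1:
  fixes b :: "'n::finite \<Rightarrow> 'v::real_vector"
    and i1 i2 :: 'n
    and S :: "real^2^'n"
    and \<beta> :: real and m :: nat
    and \<Sigma> :: "nat \<Rightarrow> real"
  assumes "dim (UNIV :: 'v set) = 2"
    and "\<And>l. b l \<noteq> 0"
    and "full_rank_lattice (int_span (range b))"
    and "i1 \<noteq> i2"
    and "lattice_basis {b i1, b i2} (int_span (range b))"
    and "\<And>l i. S $ l $ i \<in> \<int>"
    and "\<And>l. b l = (S $ l $ 1) *\<^sub>R b i1 + (S $ l $ 2) *\<^sub>R b i2"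
    and "0 < \<beta>" and "\<beta> < 1" and "m \<ge> 1"
    and "\<And>n. n \<ge> 1 \<Longrightarrow> \<Sigma> n \<in>
           {F n (f_inv S), F_beta S \<beta> n (f_inv S),
            F n (f_inv_taylor S 1), F_beta S \<beta> n (f_inv_taylor S m),
            I n (f_inv S), I_beta S \<beta> n (f_inv S),
            I n (f_inv_taylor S 1), I_beta S \<beta> n (f_inv_taylor S m)}"
  shows "(\<lambda>n. \<Sigma> n - real CARD('n) / (pi * sqrt (det (transpose S ** S))) * (real n)\<^sup>2 * ln (real n))
           \<in> O(\<lambda>n. (real n)\<^sup>2)"
proof -
  have "full_rank_lattice (int_span {b i1, b i2})"
    using assms(3,5) by (simp add: lattice_basis_def)
  note gen = full_rank_generators[OF assms(1) this]
  have rel: "x = 0 \<and> y = 0" if "x *\<^sub>R b i1 + y *\<^sub>R b i2 = 0" for x y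
    using linear_relation_trivial[OF gen(1) that]
      linear_relation_trivial[OF gen(2), of y x] that by (simp add: add.commute)
  \<comment> \<open>Subtracting b_1 from its own expansion leaves a real relation between b_1 and
    b_2, which must be trivial; likewise for b_2.\<close>
  have "S $ i1 $ 1 - 1 = 0 \<and> S $ i1 $ 2 = 0"
    using assms(7)[of i1] by (intro rel) (simp add: algebra_simps)
  moreover have "S $ i2 $ 1 = 0 \<and> S $ i2 $ 2 - 1 = 0"
    using assms(7)[of i2] by (intro rel) (simp add: algebra_simps)
  ultimately interpret step_vectors S i1 i2 by unfold_locales auto
  define Gs where "Gs =
    {\<lambda>n. F n (f_inv S), \<lambda>n. F_beta S \<beta> n (f_inv S),
     \<lambda>n. F n (f_inv_taylor S 1), \<lambda>n. F_beta S \<beta> n (f_inv_taylor S m),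
     \<lambda>n. I n (f_inv S), \<lambda>n. I_beta S \<beta> n (f_inv S),
     \<lambda>n. I n (f_inv_taylor S 1), \<lambda>n. I_beta S \<beta> n (f_inv_taylor S m)}"
  have "(\<lambda>n. \<Sigma> n - main_term n) \<in> O(\<lambda>n. (real n)\<^sup>2)"
  proof (rule bigo_pointwise_member[of "(\<lambda>G n. G n - main_term n) ` Gs"])
    show "finite ((\<lambda>G n. G n - main_term n) ` Gs)" by (simp add: Gs_def)
    show "h \<in> O(\<lambda>n. (real n)\<^sup>2)" if "h \<in> (\<lambda>G n. G n - main_term n) ` Gs" for h
      using that Dom_asymptotics Dom_beta_asymptotics[OF assms(8-10)]
      unfolding Gs_def by (elim imageE insertE emptyE; simp only:)
    show "\<exists>h\<in>(\<lambda>G n. G n - main_term n) ` Gs. \<Sigma> n - main_term n = h n" if "n \<ge> 1" for n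
      using assms(11)[OF that] by (simp add: Gs_def)
  qed
  thus ?thesis by (simp only: main_term_def)
qed

end
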